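(* Let $\mathbb K$ be a field of characteristic zero and let $\mathfrak m_0$ be the Lie algebra over $\mathbb K$ with basis $e_1,e_2,e_3,\dots$ and brackets $[e_1,e_i]=e_{i+1}$ for $i\ge2$ (other brackets of basis elements being zero), with dual elements $e^1,e^2,\dots$. Let $n\ge3$. Up to equivalence, the defined and trivial $n$-fold Massey products $\langle\omega_1,\dots,\omega_n\rangle$ of non-zero classes $\omega_i\in H^1(\mathfrak m_0)=\mathrm{Span}(e^1,e^2)$ are the following (i.e. each product listed is defined and trivial, and every defined and trivial $n$-fold Massey product of non-zero classes of $H^1(\mathfrak m_0)$ is equivalent to one of those listed): - $A^{n+1}_\lambda$: $\langle\underbrace{\alpha e^1+\beta e^2,\dots,\alpha e^1+\beta e^2}_{n}\rangle$, with $\lambda=(\alpha:\beta)\in\mathbb KP^1$; - $B^{n+1}_{\alpha,\beta}$: $\langle\lambda_1e^1+e^2,\lambda_2e^1+e^2,\dots,\lambda_ne^1+e^2\rangle$, with $\lambda_i=i\alpha+\beta$, $\alpha,\beta\in\mathbb K$, $\alpha\ne0$; - $C^{n+1}_{l,\alpha}$: $\langle\underbrace{e^1,\dots,e^1}_{l},\,e^2+\alpha e^1,\,\underbrace{e^1,\dots,e^1}_{n-l-1}\rangle$, with $\alpha\in\mathbb K$, $0\le l\le n-1$; - $D^{2k+3}_{\alpha,\beta}$ (only when $n=2k+2$ with $k\ge1$): $\langle e^2+\alpha e^1,\underbrace{e^1,\dots,e^1}_{2k},e^2+\beta e^1\rangle$, with $\alpha,\beta\in\mathbb K$.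
   Context: Cochains. $\Lambda^*(\mathfrak m_0)=\Lambda^*(e^1,e^2,\dots)$ is the exterior algebra on the dual elements $e^i$, with derivation differential $de^1=de^2=0$, $de^i=e^1\wedge e^{i-1}$ for $i\ge3$; $H^*(\mathfrak m_0)$ is its cohomology, and $H^1(\mathfrak m_0)$ is spanned by (the classes of) $e^1,e^2$. Massey products of 1-classes. For closed 1-forms $\omega_1,\dots,\omega_n$, a defining system for $\langle\omega_1,\dots,\omega_n\rangle$ is a collection of 1-forms $a(i,j)$, $1\le i\le j\le n$, $(i,j)\ne(1,n)$, with $a(i,i)=\omega_i$ and $d\,a(i,j)=\sum_{r=i}^{j-1}a(i,r)\wedge a(r+1,j)$ for $i<j$, $(i,j)\ne(1,n)$. Its related cocycle is $c=\sum_{r=1}^{n-1}a(1,r)\wedge a(r+1,n)$. The product $\langle\omega_1,\dots,\omega_n\rangle$ is defined if a defining system exists; it is then the set of all classes $[c]\in H^2$ of related cocycles. It is trivial if it contains $0$. Equivalence. A defining system, together with an arbitrary 1-form $a(1,n)$, is viewed as a strictly upper triangular $(n+1)\times(n+1)$ matrix $A$ whose $(i,j+1)$ entry is $a(i,j)$ (the matrix of a formal connection for $\langle\omega_1,\dots,\omega_n\rangle$). Two such matrices $A,A'$ are equivalent if $A'=C^{-1}AC$ for some $C\in GL(n+1,\mathbb K)$. Two $n$-fold Massey products are equivalent if they admit matrices of formal connections which are equivalent. (For instance $\langle\omega_1,\dots,\omega_n\rangle$ and $\langle x_1\omega_1,\dots,x_n\omega_n\rangle$ with all $x_i\in\mathbb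 K\setminus\{0\}$ are equivalent, via a diagonal $C$.) *)

theory Defs
  imports "HOL-Library.Poly_Mapping" "Jordan_Normal_Form.Matrix"
begin

section \<open>The cochain complex of the Lie algebra \<open>m\<^sub>0\<close>\<close>

text \<open>
  The exterior algebra on \<open>e\<^sup>1, e\<^sup>2, \<dots>\<close>: a form is a finite linear combination of the
  monomials \<open>e\<^sup>I = e\<^sup>i\<^sup>1 \<and> \<dots> \<and> e\<^sup>i\<^sup>p\<close>, one for each finite set \<open>I = {i\<^sub>1 < \<dots> < i\<^sub>p}\<close> of positive
  integers. The type also contains monomials for infinite sets and for sets containing \<open>0\<close>; they are
  excluded by the carriers \<open>forms p\<close>.
\<close>

type_synonym 'k form = "nat set \<Rightarrow>\<^sub>0 'k"

definition forms :: "nat \<Rightarrow> ('k::field_char_0) form set" where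
  "forms p = {x. \<forall>I\<in>Poly_Mapping.keys x. finite I \<and> card I = p \<and> 0 \<notin> I}"

definition scale :: "'k::field_char_0 \<Rightarrow> 'k form \<Rightarrow> 'k form" (infixr "*\<^sub>F" 75) where
  "c *\<^sub>F x = Poly_Mapping.map ((*) c) x"

definition gen :: "nat \<Rightarrow> ('k::field_char_0) form" where
  "gen i = Poly_Mapping.single {i} 1"

definition unit_form :: "('k::field_char_0) form" where
  "unit_form = Poly_Mapping.single {} 1"

text \<open>
  \<open>e\<^sup>I \<and> e\<^sup>J = \<plusminus> e\<^bsup>I \<union> J\<^esup>\<close> for disjoint \<open>I\<close>, \<open>J\<close>, with the sign of the permutation that sorts the
  concatenation of \<open>I\<close> and \<open>J\<close>, and \<open>0\<close> otherwise.
\<close>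

definition wedge_sign :: "nat set \<Rightarrow> nat set \<Rightarrow> 'k::field_char_0" where
  "wedge_sign I J = (if I \<inter> J = {} then (- 1) ^ card {(i, j). i \<in> I \<and> j \<in> J \<and> j < i} else 0)"

definition wedge :: "('k::field_char_0) form \<Rightarrow> 'k form \<Rightarrow> 'k form" (infixr "\<and>\<^sub>F" 70) where
  "x \<and>\<^sub>F y = (\<Sum>I\<in>Poly_Mapping.keys x. \<Sum>J\<in>Poly_Mapping.keys y.
     Poly_Mapping.single (I \<union> J)
       (wedge_sign I J * Poly_Mapping.lookup x I * Poly_Mapping.lookup y J))"

definition d_gen :: "nat \<Rightarrow> ('k::field_char_0) form" where
  "d_gen i = (if i \<ge> 3 then gen 1 \<and>\<^sub>F gen (i - 1) else 0)"

text \<open>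
  The extension of \<open>d_gen\<close> to an antiderivation, on the monomial \<open>e\<^sup>i\<^sup>1 \<and> \<dots> \<and> e\<^sup>i\<^sup>p\<close> given by the list
  of its indices: \<open>d (e\<^sup>i \<and> \<omega>) = d e\<^sup>i \<and> \<omega> - e\<^sup>i \<and> d \<omega>\<close>.
\<close>

primrec d_mono :: "nat list \<Rightarrow> ('k::field_char_0) form" where
  "d_mono [] = 0"
| "d_mono (i # is) = d_gen i \<and>\<^sub>F foldr (\<lambda>j x. gen j \<and>\<^sub>F x) is unit_form - gen i \<and>\<^sub>F d_mono is"

definition d :: "('k::field_char_0) form \<Rightarrow> 'k form" where
  "d x = (\<Sum>I\<in>Poly_Mapping.keys x. Poly_Mapping.lookup x I *\<^sub>F d_mono (sorted_list_of_set I))"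

text \<open>
  The differential is that of the Lie algebra: \<open>m0_bracket i j\<close> is \<open>[e\<^sub>i, e\<^sub>j]\<close>, as a linear
  combination of \<open>e\<^sub>1, e\<^sub>2, \<dots>\<close>, and \<open>d e\<^sup>k (e\<^sub>i, e\<^sub>j) = e\<^sup>k [e\<^sub>i, e\<^sub>j]\<close>.
\<close>

definition m0_bracket :: "nat \<Rightarrow> nat \<Rightarrow> (nat \<Rightarrow>\<^sub>0 'k::field_char_0)" where
  "m0_bracket i j =
     (if i = 1 \<and> j \<ge> 2 then Poly_Mapping.single (j + 1) 1
      else if j = 1 \<and> i \<ge> 2 then - Poly_Mapping.single (i + 1) 1
      else 0)"

lemma wedge_gen_gen:
  "gen i \<and>\<^sub>F gen j = Poly_Mapping.single {i, j} (wedge_sign {i} {j} :: 'k::field_char_0)"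
  by (simp add: wedge_def gen_def insert_commute)

lemma wedge_sign_gen: "i < j \<Longrightarrow> wedge_sign {i} {j} = (1 :: 'k::field_char_0)"
proof -
  assume "i < j"
  then have "{(a, b). a \<in> {i} \<and> b \<in> {j} \<and> b < a} = {}" by auto
  then show ?thesis using \<open>i < j\<close> by (simp only: wedge_sign_def) simp
qed

lemma d_gen_m0_bracket:
  fixes i j k :: nat
  assumes "1 \<le> i" "i < j"
  shows "Poly_Mapping.lookup (d_gen k) {i, j} = (Poly_Mapping.lookup (m0_bracket i j) k :: 'k::field_char_0)"
proof (cases "k \<ge> 3")
  case True
  then have "1 < k - 1" by simp
  have "d_gen k = Poly_Mapping.single {1, k - 1} (1 :: 'k)"
    using True by (simp only: d_gen_def wedge_gen_gen wedge_sign_gen[OF \<open>1 < k - 1\<close>]) simp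
  moreover have "{1, k - 1} = {i, j} \<longleftrightarrow> i = 1 \<and> k = j + 1"
    using assms True by (auto simp: doubleton_eq_iff)
  ultimately show ?thesis
    using assms True by (auto simp: m0_bracket_def lookup_single when_def)
next
  case False
  then show ?thesis
    using assms by (auto simp: d_gen_def m0_bracket_def lookup_single when_def)
qed

lemma unit_wedge_right: "x \<and>\<^sub>F unit_form = x"
proof -
  have "x \<and>\<^sub>F unit_form = (\<Sum>I\<in>Poly_Mapping.keys x. Poly_Mapping.single I (Poly_Mapping.lookup x I))"
    by (simp add: wedge_def unit_form_def wedge_sign_def)
  also have "\<dots> = x"
    by (rule poly_mapping_eqI) (auto simp: lookup_sum lookup_single when_def in_keys_iff)
  finally show ?thesis .
qed

lemma d_gen_form: "d (gen i) = (d_gen i :: 'k::field_char_0 form)"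
proof -
  have "1 *\<^sub>F x = x" for x :: "'k form"
    by (rule poly_mapping_eqI) (simp add: scale_def map.rep_eq when_def)
  moreover have "x \<and>\<^sub>F 0 = 0" for x :: "'k form"
    by (simp add: wedge_def)
  ultimately show ?thesis
    by (simp add: d_def gen_def[of i] unit_wedge_right)
qed

definition cocycles :: "nat \<Rightarrow> ('k::field_char_0) form set" where
  "cocycles p = {x \<in> forms p. d x = 0}"

primrec coboundaries :: "nat \<Rightarrow> ('k::field_char_0) form set" where
  "coboundaries 0 = {0}"
| "coboundaries (Suc p) = d ` forms p"

text \<open>The class of a cocycle \<open>c\<close> in \<open>H\<^sup>p\<close>, as a coset; the zero of \<open>H\<^sup>p\<close> is \<open>coh_class p 0\<close>.\<close>

definition coh_class :: "nat \<Rightarrow> ('k::field_char_0) form \<Rightarrow> 'k form set" where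
  "coh_class p c = {c + b | b. b \<in> coboundaries p}"

definition nonzero_H1 :: "('k::field_char_0) form \<Rightarrow> bool" where
  "nonzero_H1 \<omega> \<longleftrightarrow> \<omega> \<in> cocycles 1 \<and> coh_class 1 \<omega> \<noteq> coh_class 1 0"

lemma cocycles_1:
  "cocycles 1 = {\<alpha> *\<^sub>F gen 1 + \<beta> *\<^sub>F gen 2 | \<alpha> \<beta> :: 'k::field_char_0. True}"
proof -
  let ?lk = Poly_Mapping.lookup
  have lk_scale: "?lk (c *\<^sub>F x) I = c * ?lk x I" for c and x :: "'k form" and I
    by (simp add: scale_def map.rep_eq when_def)
  have d_form1: "d x = (\<Sum>I\<in>Poly_Mapping.keys x. ?lk x I *\<^sub>F d_gen (the_elem I))"
    if "x \<in> forms 1" for x :: "'k form"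
    unfolding d_def
  proof (rule sum.cong[OF refl])
    fix I assume "I \<in> Poly_Mapping.keys x"
    then obtain i where "I = {i}"
      using \<open>x \<in> forms 1\<close> by (auto simp: forms_def card_1_singleton_iff)
    moreover have "y \<and>\<^sub>F 0 = 0" for y :: "'k form"
      by (simp add: wedge_def)
    ultimately show "?lk x I *\<^sub>F d_mono (sorted_list_of_set I) = ?lk x I *\<^sub>F d_gen (the_elem I)"
      by (simp add: unit_wedge_right)
  qed
  have lk_d: "?lk (d x) {1, k} = ?lk x {k + 1}" if "x \<in> forms 1" "k \<ge> 2" for x :: "'k form" and k
  proof -
    have "?lk (d x) {1, k} = (\<Sum>I\<in>Poly_Mapping.keys x. ?lk x I * ?lk (d_gen (the_elem I)) {1, k})"
      by (simp only: d_form1[OF that(1)] lookup_sum lk_scale)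
    also have "\<dots> = (\<Sum>I\<in>Poly_Mapping.keys x. if I = {k + 1} then ?lk x I else 0)"
    proof (rule sum.cong[OF refl])
      fix I assume "I \<in> Poly_Mapping.keys x"
      then obtain i where "I = {i}"
        using \<open>x \<in> forms 1\<close> by (auto simp: forms_def card_1_singleton_iff)
      then show "?lk x I * ?lk (d_gen (the_elem I)) {1, k} = (if I = {k + 1} then ?lk x I else 0)"
        using \<open>k \<ge> 2\<close> by (simp add: d_gen_m0_bracket m0_bracket_def lookup_single when_def)
    qed
    also have "\<dots> = ?lk x {k + 1}"
      by (simp add: in_keys_iff)
    finally show ?thesis .
  qed
  show ?thesis
  proof (intro subset_antisym subsetI)
    fix x :: "'k form" assume "x \<in> cocycles 1"
    then have x: "x \<in> forms 1" and "d x = 0" by (auto simp: cocycles_def)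
    have zero: "?lk x I = 0" if "I \<noteq> {1}" "I \<noteq> {2}" for I
    proof (rule ccontr)
      assume nz: "?lk x I \<noteq> 0"
      then have "card I = 1" "0 \<notin> I"
        using x by (auto simp: forms_def in_keys_iff)
      then obtain i where i: "I = {i}" "i \<noteq> 0"
        by (auto simp: card_1_singleton_iff)
      then have "i - 1 \<ge> 2" "i - 1 + 1 = i" using that by auto
      then show False
        using lk_d[OF x, of "i - 1"] \<open>d x = 0\<close> nz i by simp
    qed
    have "x = ?lk x {1} *\<^sub>F gen 1 + ?lk x {2} *\<^sub>F gen 2"
    proof (rule poly_mapping_eqI)
      fix I
      show "?lk x I = ?lk (?lk x {1} *\<^sub>F gen 1 + ?lk x {2} *\<^sub>F gen 2) I"
        using zero[of I] by (auto simp: lookup_add lk_scale gen_def lookup_single when_def)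
    qed
    then show "x \<in> {\<alpha> *\<^sub>F gen 1 + \<beta> *\<^sub>F gen 2 | \<alpha> \<beta>. True}" by blast
  next
    fix x :: "'k form" assume "x \<in> {\<alpha> *\<^sub>F gen 1 + \<beta> *\<^sub>F gen 2 | \<alpha> \<beta>. True}"
    then obtain \<alpha> \<beta> where x: "x = \<alpha> *\<^sub>F gen 1 + \<beta> *\<^sub>F gen 2" by blast
    then have keys: "Poly_Mapping.keys x \<subseteq> {{1}, {2}}"
      by (auto simp: in_keys_iff lookup_add lk_scale gen_def lookup_single when_def split: if_splits)
    then have x1: "x \<in> forms 1" by (auto simp: forms_def)
    have "?lk x I *\<^sub>F d_gen (the_elem I) = 0" if "I \<in> Poly_Mapping.keys x" for I
      using keys that by (intro poly_mapping_eqI) (auto simp: d_gen_def lk_scale)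
    then have "d x = 0" by (simp add: d_form1[OF x1])
    with x1 show "x \<in> cocycles 1" by (simp add: cocycles_def)
  qed
qed


section \<open>Massey products of 1-classes\<close>

text \<open>
  The forms \<open>\<omega>\<^sub>1, \<dots>, \<omega>\<^sub>n\<close> are given as a list \<open>ws\<close> of length \<open>n\<close>, so that \<open>\<omega>\<^sub>i\<close> is \<open>ws ! (i - 1)\<close>;
  the indices of \<open>a\<close> are those of the mathematical notation, \<open>1 \<le> i \<le> j \<le> n\<close>.
\<close>

definition defining_system :: "('k::field_char_0) form list \<Rightarrow> (nat \<Rightarrow> nat \<Rightarrow> 'k form) \<Rightarrow> bool" where
  "defining_system ws a \<longleftrightarrow> (let n = length ws in
     (\<forall>i j. 1 \<le> i \<and> i \<le> j \<and> j \<le> n \<and> (i, j) \<noteq> (1, n) \<longrightarrow> a i j \<in> forms 1) \<and>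
     (\<forall>i. 1 \<le> i \<and> i \<le> n \<longrightarrow> a i i = ws ! (i - 1)) \<and>
     (\<forall>i j. 1 \<le> i \<and> i < j \<and> j \<le> n \<and> (i, j) \<noteq> (1, n) \<longrightarrow>
        d (a i j) = (\<Sum>r = i..j - 1. a i r \<and>\<^sub>F a (r + 1) j)))"

definition related_cocycle :: "('k::field_char_0) form list \<Rightarrow> (nat \<Rightarrow> nat \<Rightarrow> 'k form) \<Rightarrow> 'k form" where
  "related_cocycle ws a = (\<Sum>r = 1..length ws - 1. a 1 r \<and>\<^sub>F a (r + 1) (length ws))"

definition massey_product :: "('k::field_char_0) form list \<Rightarrow> 'k form set set" where
  "massey_product ws = {coh_class 2 (related_cocycle ws a) | a. defining_system ws a}"

definition massey_defined :: "('k::field_char_0) form list \<Rightarrow> bool" where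
  "massey_defined ws \<longleftrightarrow> (\<exists>a. defining_system ws a)"

definition massey_trivial :: "('k::field_char_0) form list \<Rightarrow> bool" where
  "massey_trivial ws \<longleftrightarrow> coh_class 2 0 \<in> massey_product ws"


section \<open>Equivalence of Massey products\<close>

text \<open>
  The matrix \<open>A\<close> with \<open>(i, j + 1)\<close> entry \<open>a(i, j)\<close> for 1-based row and column numbers. Rows and columns
  of the library's matrices are numbered from \<open>0\<close>, so the entry at \<open>(r, s)\<close> is \<open>a(r + 1, s)\<close>.
\<close>

definition connection_matrix :: "nat \<Rightarrow> (nat \<Rightarrow> nat \<Rightarrow> ('k::field_char_0) form) \<Rightarrow> 'k form mat" where
  "connection_matrix n a = mat (n + 1) (n + 1) (\<lambda>(r, s). if r < s then a (r + 1) s else 0)"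

definition formal_connection :: "('k::field_char_0) form list \<Rightarrow> 'k form mat \<Rightarrow> bool" where
  "formal_connection ws A \<longleftrightarrow> (\<exists>a. defining_system ws a \<and> a 1 (length ws) \<in> forms 1 \<and>
     A = connection_matrix (length ws) a)"

text \<open>Products of a scalar matrix with a matrix of forms.\<close>

definition lmult_mat :: "('k::field_char_0) mat \<Rightarrow> 'k form mat \<Rightarrow> 'k form mat" where
  "lmult_mat P A = mat (dim_row P) (dim_col A)
     (\<lambda>(r, s). \<Sum>t<dim_row A. P $$ (r, t) *\<^sub>F A $$ (t, s))"

definition rmult_mat :: "('k::field_char_0) form mat \<Rightarrow> 'k mat \<Rightarrow> 'k form mat" where
  "rmult_mat A P = mat (dim_row A) (dim_col P)
     (\<lambda>(r, s). \<Sum>t<dim_row P. P $$ (t, s) *\<^sub>F A $$ (r, t))"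

definition equivalent_mat :: "nat \<Rightarrow> ('k::field_char_0) form mat \<Rightarrow> 'k form mat \<Rightarrow> bool" where
  "equivalent_mat m A A' \<longleftrightarrow> (\<exists>C C'. C \<in> carrier_mat m m \<and> C' \<in> carrier_mat m m \<and>
     inverts_mat C C' \<and> inverts_mat C' C \<and> A' = rmult_mat (lmult_mat C' A) C)"

definition massey_equivalent :: "('k::field_char_0) form list \<Rightarrow> 'k form list \<Rightarrow> bool" where
  "massey_equivalent ws vs \<longleftrightarrow> length ws = length vs \<and>
     (\<exists>A A'. formal_connection ws A \<and> formal_connection vs A' \<and> equivalent_mat (length ws + 1) A A')"


section \<open>The four families\<close>

definition family_A :: "nat \<Rightarrow> 'k::field_char_0 \<Rightarrow> 'k \<Rightarrow> 'k form list" where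
  "family_A n \<alpha> \<beta> = replicate n (\<alpha> *\<^sub>F gen 1 + \<beta> *\<^sub>F gen 2)"

definition family_B :: "nat \<Rightarrow> 'k::field_char_0 \<Rightarrow> 'k \<Rightarrow> 'k form list" where
  "family_B n \<alpha> \<beta> = map (\<lambda>i. (of_nat i * \<alpha> + \<beta>) *\<^sub>F gen 1 + gen 2) [1..<n + 1]"

definition family_C :: "nat \<Rightarrow> nat \<Rightarrow> 'k::field_char_0 \<Rightarrow> 'k form list" where
  "family_C n l \<alpha> = replicate l (gen 1) @ [gen 2 + \<alpha> *\<^sub>F gen 1] @ replicate (n - l - 1) (gen 1)"

definition family_D :: "nat \<Rightarrow> 'k::field_char_0 \<Rightarrow> 'k \<Rightarrow> 'k form list" where
  "family_D k \<alpha> \<beta> = [gen 2 + \<alpha> *\<^sub>F gen 1] @ replicate (2 * k) (gen 1) @ [gen 2 + \<beta> *\<^sub>F gen 1]"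

text \<open>
  A point \<open>\<lambda> = (\<alpha> : \<beta>)\<close> of the projective line is represented by any of its pairs of homogeneous
  coordinates.
\<close>

definition listed_products :: "nat \<Rightarrow> ('k::field_char_0) form list set" where
  "listed_products n =
     {family_A n \<alpha> \<beta> | \<alpha> \<beta>. (\<alpha>, \<beta>) \<noteq> (0, 0)} \<union>
     {family_B n \<alpha> \<beta> | \<alpha> \<beta>. \<alpha> \<noteq> 0} \<union>
     {family_C n l \<alpha> | l \<alpha>. l \<le> n - 1} \<union>
     {family_D k \<alpha> \<beta> | k \<alpha> \<beta>. n = 2 * k + 2 \<and> k \<ge> 1}"

end

theory Submission
  imports Defs
begin

text \<open>
  An \<open>n\<close>-fold product is trivial iff some strictly upper triangular matrix of 1-forms satisfies
  \<open>dA = A \<and> A\<close>, i.e. iff there are strictly upper triangular matrices \<open>X\<close>, \<open>Y\<close> (the images of \<open>e\<^sub>1\<close>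
  and \<open>e\<^sub>2\<close>) whose superdiagonals are the coefficients of the \<open>\<omega>\<^sub>i\<close> and for which the \<open>ad\<^sub>X\<^sup>u Y\<close>
  commute. Since \<open>m\<^sub>0\<close> is graded, all other diagonals of \<open>X\<close> and \<open>Y\<close> may be taken to be zero, which
  leaves polynomial conditions on the superdiagonals \<open>a\<close>, \<open>b\<close>. After conjugation with a diagonal
  matrix, each \<open>b\<^sub>i\<close> is \<open>1\<close>, or \<open>b\<^sub>i = 0\<close> and \<open>a\<^sub>i = 1\<close>. Now \<open>[Y, [X, Y]] = 0\<close> says that two adjacent
  non-zero \<open>b\<^sub>i\<close> force all \<open>b\<^sub>i\<close> to be non-zero, with \<open>a\<close> an arithmetic progression (families A and B).
  If neighbouring non-zero \<open>b\<^sub>p\<close> and \<open>b\<^sub>q\<close> are separated by \<open>m \<ge> 1\<close> zeros, then \<open>[Y, ad\<^sub>X\<^sup>m Y] = 0\<close> forces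
  \<open>m\<close> to be even, and \<open>[Y, ad\<^bsub>X\<^esub>\<^bsup>m + 1\<^esup> Y] = 0\<close> forces \<open>p = 1\<close> and \<open>q = n\<close> (family D).
\<close>

section \<open>Coefficients of forms\<close>

abbreviation coeff1 :: "('k::field_char_0) form \<Rightarrow> nat \<Rightarrow> 'k" where
  "coeff1 x k \<equiv> Poly_Mapping.lookup x {k}"

lemma lookup_scale: "Poly_Mapping.lookup (c *\<^sub>F x) I = c * Poly_Mapping.lookup x I"
  by (simp add: scale_def map.rep_eq when_def)

lemma scale_0 [simp]: "0 *\<^sub>F x = 0"
  by (rule poly_mapping_eqI) (simp add: lookup_scale)

lemma scale_1 [simp]: "1 *\<^sub>F x = x"
  by (rule poly_mapping_eqI) (simp add: lookup_scale)

lemma scale_scale: "c *\<^sub>F (e *\<^sub>F x) = (c * e) *\<^sub>F x"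
  by (rule poly_mapping_eqI) (simp add: lookup_scale mult.assoc)

lemma scale_add_right: "c *\<^sub>F (x + y) = c *\<^sub>F x + c *\<^sub>F y"
  by (rule poly_mapping_eqI) (simp add: lookup_scale lookup_add distrib_left)

lemma coeff1_gen: "coeff1 (gen i) k = (if k = i then 1 else 0)"
  by (auto simp: gen_def lookup_single when_def)

lemma forms_iff:
  "x \<in> forms p \<longleftrightarrow> (\<forall>I. Poly_Mapping.lookup x I \<noteq> 0 \<longrightarrow> finite I \<and> card I = p \<and> 0 \<notin> I)"
  by (auto simp: forms_def in_keys_iff)

lemma zero_in_forms: "0 \<in> forms p"
  by (simp add: forms_iff)

lemma add_in_forms: "x \<in> forms p \<Longrightarrow> y \<in> forms p \<Longrightarrow> x + y \<in> forms p"
  unfolding forms_iff lookup_add by (metis add.right_neutral)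

lemma diff_in_forms: "x \<in> forms p \<Longrightarrow> y \<in> forms p \<Longrightarrow> x - y \<in> forms p"
  unfolding forms_iff lookup_minus by (metis diff_zero)

lemma scale_in_forms: "x \<in> forms p \<Longrightarrow> c *\<^sub>F x \<in> forms p"
  by (simp add: forms_iff lookup_scale)

lemma sum_in_forms: "(\<And>r. r \<in> R \<Longrightarrow> f r \<in> forms p) \<Longrightarrow> sum f R \<in> forms p"
  by (induction R rule: infinite_finite_induct) (auto intro: zero_in_forms add_in_forms)

lemma gen_in_forms: "i \<ge> 1 \<Longrightarrow> gen i \<in> forms 1"
  by (auto simp: forms_iff gen_def lookup_single when_def)

lemma forms_1_keysE:
  assumes "x \<in> forms 1" "I \<in> Poly_Mapping.keys x"
  obtains i where "I = {i}" "i \<ge> 1"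
  using assms by (auto simp: forms_def card_1_singleton_iff Suc_le_eq)

text \<open>The carrier admits only two-element sets of positive indices, so equations between
  2-forms can be checked on pairs \<open>k < l\<close>. This is how flatness becomes a family of
  scalar equations.\<close>

lemma forms_2_eqI:
  assumes "x \<in> forms 2" "y \<in> forms 2"
    and eq: "\<And>k l. 1 \<le> k \<Longrightarrow> k < l \<Longrightarrow> Poly_Mapping.lookup x {k, l} = Poly_Mapping.lookup y {k, l}"
  shows "x = y"
proof (rule poly_mapping_eqI)
  fix I
  show "Poly_Mapping.lookup x I = Poly_Mapping.lookup y I"
  proof (cases "card I = 2 \<and> 0 \<notin> I")
    case True
    then obtain p q where "I = {p, q}" "p \<noteq> q" "p \<noteq> 0" "q \<noteq> 0"
      by (auto simp: card_2_iff)
    then show ?thesis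
      using eq[of p q] eq[of q p] by (cases "p < q") (auto simp: insert_commute)
  next
    case False
    then show ?thesis using assms(1,2) unfolding forms_iff by metis
  qed
qed

lemma wedge_in_forms_2:
  assumes "x \<in> forms 1" "y \<in> forms 1"
  shows "x \<and>\<^sub>F y \<in> forms 2"
  unfolding wedge_def
proof (intro sum_in_forms)
  fix I J assume "I \<in> Poly_Mapping.keys x" "J \<in> Poly_Mapping.keys y"
  then obtain i j where "I = {i}" "i \<ge> 1" "J = {j}" "j \<ge> 1"
    using assms by (metis forms_1_keysE)
  then show "Poly_Mapping.single (I \<union> J)
      (wedge_sign I J * Poly_Mapping.lookup x I * Poly_Mapping.lookup y J) \<in> forms 2"
    by (cases "i = j") (auto simp: forms_iff lookup_single when_def wedge_sign_def)
qed

lemma wedge_sign_gen_swap: "i < j \<Longrightarrow> wedge_sign {j} {i} = (- 1 :: 'k::field_char_0)"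
proof -
  assume "i < j"
  then have "{(a, b). a \<in> {j} \<and> b \<in> {i} \<and> b < a} = {(j, i)}" by auto
  then show ?thesis using \<open>i < j\<close> by (simp only: wedge_sign_def) simp
qed

lemma lookup_wedge:
  fixes x y :: "'k::field_char_0 form"
  assumes "x \<in> forms 1" "y \<in> forms 1" "k < l"
  shows "Poly_Mapping.lookup (x \<and>\<^sub>F y) {k, l} = coeff1 x k * coeff1 y l - coeff1 x l * coeff1 y k"
proof -
  define g :: "nat set \<Rightarrow> nat set \<Rightarrow> 'k" where
    "g I J = (if I \<union> J = {k, l} then wedge_sign I J * Poly_Mapping.lookup x I * Poly_Mapping.lookup y J else 0)"
    for I J
  have "Poly_Mapping.lookup (x \<and>\<^sub>F y) {k, l} = (\<Sum>I\<in>Poly_Mapping.keys x. \<Sum>J\<in>Poly_Mapping.keys y. g I J)"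
    unfolding wedge_def lookup_sum by (intro sum.cong refl) (auto simp: lookup_single when_def g_def)
  \<comment> \<open>Key sets are traded for the fixed set \<open>{{k}, {l}}\<close>: other keys
    never unite to \<open>{k, l}\<close>, and singletons that are not keys have coefficient
    zero.\<close>
  also have "\<dots> = (\<Sum>I\<in>Poly_Mapping.keys x. \<Sum>J\<in>{{k}, {l}}. g I J)"
  proof (rule sum.cong[OF refl], rule sum.mono_neutral_cong)
    fix I J assume I: "I \<in> Poly_Mapping.keys x"
    { assume "J \<in> {{k}, {l}} - Poly_Mapping.keys y"
      then show "g I J = 0" by (auto simp: g_def in_keys_iff) }
    assume J: "J \<in> Poly_Mapping.keys y - {{k}, {l}}"
    then obtain i j where "I = {i}" "J = {j}"
      using I assms by (metis DiffD1 forms_1_keysE)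
    then show "g I J = 0"
      using J by (auto simp: g_def doubleton_eq_iff)
  qed auto
  also have "\<dots> = (\<Sum>I\<in>{{k}, {l}}. \<Sum>J\<in>{{k}, {l}}. g I J)"
  proof (intro sum.mono_neutral_cong refl)
    fix I
    { assume "I \<in> {{k}, {l}} - Poly_Mapping.keys x"
      then show "(\<Sum>J\<in>{{k}, {l}}. g I J) = 0"
        by (intro sum.neutral) (auto simp: g_def in_keys_iff) }
    assume I: "I \<in> Poly_Mapping.keys x - {{k}, {l}}"
    then obtain i where "I = {i}" using assms by (metis DiffD1 forms_1_keysE)
    then show "(\<Sum>J\<in>{{k}, {l}}. g I J) = 0"
      using I by (auto simp: g_def doubleton_eq_iff intro!: sum.neutral)
  qed auto
  also have "\<dots> = coeff1 x k * coeff1 y l - coeff1 x l * coeff1 y k"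
    using assms(3)
    by (auto simp: g_def wedge_sign_gen wedge_sign_gen_swap insert_commute)
  finally show ?thesis .
qed

lemma d_forms_1:
  assumes "x \<in> forms 1"
  shows "d x = (\<Sum>I\<in>Poly_Mapping.keys x. Poly_Mapping.lookup x I *\<^sub>F d_gen (the_elem I))"
  unfolding d_def
proof (rule sum.cong[OF refl])
  fix I assume "I \<in> Poly_Mapping.keys x"
  then obtain i where "I = {i}" using assms by (metis forms_1_keysE)
  then show "Poly_Mapping.lookup x I *\<^sub>F d_mono (sorted_list_of_set I) =
      Poly_Mapping.lookup x I *\<^sub>F d_gen (the_elem I)"
    by (simp add: unit_wedge_right wedge_def[of _ 0])
qed

lemma d_in_forms_2: "x \<in> forms 1 \<Longrightarrow> d x \<in> forms 2"
  by (auto simp: d_forms_1 d_gen_def intro!: sum_in_forms scale_in_forms wedge_in_forms_2 gen_in_forms zero_in_forms)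

text \<open>Every non-zero \<open>d_gen i\<close> is a monomial containing the index 1, and
  \<open>{1, l}\<close> arises only from \<open>d_gen (Suc l)\<close>.\<close>

lemma lookup_d:
  fixes x :: "'k::field_char_0 form"
  assumes "x \<in> forms 1" "1 \<le> k" "k < l"
  shows "Poly_Mapping.lookup (d x) {k, l} = (if k = 1 then coeff1 x (Suc l) else 0)"
proof -
  have "Poly_Mapping.lookup (d x) {k, l} =
      (\<Sum>I\<in>Poly_Mapping.keys x. Poly_Mapping.lookup x I * Poly_Mapping.lookup (d_gen (the_elem I)) {k, l})"
    by (simp only: d_forms_1[OF assms(1)] lookup_sum lookup_scale)
  also have "\<dots> = (\<Sum>I\<in>Poly_Mapping.keys x. if I = {Suc l} then (if k = 1 then Poly_Mapping.lookup x I else 0) else 0)"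
  proof (rule sum.cong[OF refl])
    fix I assume "I \<in> Poly_Mapping.keys x"
    then obtain i where "I = {i}" using assms(1) by (metis forms_1_keysE)
    then show "Poly_Mapping.lookup x I * Poly_Mapping.lookup (d_gen (the_elem I)) {k, l} =
        (if I = {Suc l} then (if k = 1 then Poly_Mapping.lookup x I else 0) else 0)"
      using assms(2,3) by (simp add: d_gen_m0_bracket m0_bracket_def lookup_single when_def)
  qed
  also have "\<dots> = (if k = 1 then coeff1 x (Suc l) else 0)"
    by (simp add: in_keys_iff)
  finally show ?thesis .
qed

text \<open>Comparing coefficients avoids the sums over key sets, which differ for \<open>x\<close>,
  \<open>y\<close> and \<open>x + y\<close>.\<close>

lemma d_add:
  assumes "x \<in> forms 1" "y \<in> forms 1"
  shows "d (x + y) = d x + d y"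
  by (rule forms_2_eqI)
    (use assms in \<open>auto simp: lookup_d lookup_add add_in_forms d_in_forms_2\<close>)

lemma d_diff:
  assumes "x \<in> forms 1" "y \<in> forms 1"
  shows "d (x - y) = d x - d y"
  by (rule forms_2_eqI)
    (use assms in \<open>auto simp: lookup_d lookup_minus diff_in_forms d_in_forms_2\<close>)

lemma d_eq_sum_wedge_iff:
  assumes "x \<in> forms 1" "\<And>r. r \<in> R \<Longrightarrow> f r \<in> forms 1" "\<And>r. r \<in> R \<Longrightarrow> g r \<in> forms 1"
  shows "d x = (\<Sum>r\<in>R. f r \<and>\<^sub>F g r) \<longleftrightarrow>
    (\<forall>k l. 1 \<le> k \<and> k < l \<longrightarrow> (if k = 1 then coeff1 x (Suc l) else 0) =
       (\<Sum>r\<in>R. coeff1 (f r) k * coeff1 (g r) l - coeff1 (f r) l * coeff1 (g r) k))"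
proof -
  have forms: "d x \<in> forms 2" "(\<Sum>r\<in>R. f r \<and>\<^sub>F g r) \<in> forms 2"
    using assms by (auto intro!: d_in_forms_2 sum_in_forms wedge_in_forms_2)
  have "d x = (\<Sum>r\<in>R. f r \<and>\<^sub>F g r) \<longleftrightarrow>
    (\<forall>k l. 1 \<le> k \<and> k < l \<longrightarrow>
       Poly_Mapping.lookup (d x) {k, l} = Poly_Mapping.lookup (\<Sum>r\<in>R. f r \<and>\<^sub>F g r) {k, l})"
    using forms_2_eqI[OF forms] by metis
  also have "\<dots> \<longleftrightarrow> (\<forall>k l. 1 \<le> k \<and> k < l \<longrightarrow> (if k = 1 then coeff1 x (Suc l) else 0) =
       (\<Sum>r\<in>R. coeff1 (f r) k * coeff1 (g r) l - coeff1 (f r) l * coeff1 (g r) k))"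
    using assms by (simp add: lookup_d lookup_sum lookup_wedge)
  finally show ?thesis .
qed

section \<open>Non-zero classes of degree one\<close>

text \<open>Differentials of 0-forms vanish, so a class in degree one consists of a single closed
  form.\<close>

lemma nonzero_H1_iff:
  "nonzero_H1 \<omega> \<longleftrightarrow> (\<exists>\<alpha> \<beta>. (\<alpha>, \<beta>) \<noteq> (0, 0) \<and> \<omega> = \<alpha> *\<^sub>F gen 1 + \<beta> *\<^sub>F gen 2)"
proof -
  have "d x = 0" if "x \<in> forms 0" for x :: "'a form"
    unfolding d_def
  proof (rule sum.neutral, rule ballI)
    fix I assume "I \<in> Poly_Mapping.keys x"
    then have "I = {}" using that by (auto simp: forms_def)
    then show "Poly_Mapping.lookup x I *\<^sub>F d_mono (sorted_list_of_set I) = 0"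
      by (intro poly_mapping_eqI) (simp add: lookup_scale)
  qed
  then have "coboundaries 1 = {0 :: 'a form}"
    using zero_in_forms by (force simp: image_iff)
  then have "coh_class 1 x = {x}" for x :: "'a form"
    by (simp add: coh_class_def)
  then have iff: "nonzero_H1 \<omega> \<longleftrightarrow> \<omega> \<in> cocycles 1 \<and> \<omega> \<noteq> 0"
    by (simp add: nonzero_H1_def)
  have "\<alpha> *\<^sub>F gen 1 + \<beta> *\<^sub>F gen 2 = (0 :: 'a form) \<longleftrightarrow> \<alpha> = 0 \<and> \<beta> = 0" for \<alpha> \<beta>
  proof
    assume "\<alpha> *\<^sub>F gen 1 + \<beta> *\<^sub>F gen 2 = (0 :: 'a form)"
    then have "coeff1 (\<alpha> *\<^sub>F gen 1 + \<beta> *\<^sub>F gen 2) k = 0" for k by simp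
    from this[of 1] this[of 2] show "\<alpha> = 0 \<and> \<beta> = 0"
      by (simp add: lookup_add lookup_scale coeff1_gen)
  qed simp
  then show ?thesis
    unfolding iff cocycles_1 by auto
qed


section \<open>Trivial Massey products as flat connections\<close>

text \<open>The Maurer-Cartan equation, now including the corner entry. For \<open>i = j\<close> the
  range \<open>{i..i - 1}\<close> is empty, so the equation says that the diagonal form is
  closed.\<close>

definition flat_connection :: "('k::field_char_0) form list \<Rightarrow> (nat \<Rightarrow> nat \<Rightarrow> 'k form) \<Rightarrow> bool" where
  "flat_connection ws a \<longleftrightarrow> (\<forall>i. 1 \<le> i \<and> i \<le> length ws \<longrightarrow> a i i = ws ! (i - 1)) \<and>
     (\<forall>i j. 1 \<le> i \<and> i \<le> j \<and> j \<le> length ws \<longrightarrow>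
        a i j \<in> forms 1 \<and> d (a i j) = (\<Sum>r = i..j - 1. a i r \<and>\<^sub>F a (Suc r) j))"

text \<open>If \<open>M\<^sub>k\<close> is the matrix of coefficients at the \<open>k\<close>-th
  generator, the scalar equations say that the bracket of \<open>M\<^sub>1\<close> and
  \<open>M\<^sub>l\<close> is the next matrix \<open>M\<^sub>l\<^sub>+\<^sub>1\<close> for
  \<open>l \<ge> 2\<close>, and that all \<open>M\<^sub>k\<close> with \<open>k \<ge> 2\<close>
  commute: a representation of the Lie algebra.\<close>

lemma flat_connection_iff:
  "flat_connection ws a \<longleftrightarrow> (\<forall>i. 1 \<le> i \<and> i \<le> length ws \<longrightarrow> a i i = ws ! (i - 1)) \<and>
     (\<forall>i j. 1 \<le> i \<and> i \<le> j \<and> j \<le> length ws \<longrightarrow> a i j \<in> forms 1) \<and>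
     (\<forall>i j k l. 1 \<le> i \<and> i \<le> j \<and> j \<le> length ws \<and> 1 \<le> k \<and> k < l \<longrightarrow>
        (if k = 1 then coeff1 (a i j) (Suc l) else 0) =
        (\<Sum>r = i..j - 1. coeff1 (a i r) k * coeff1 (a (Suc r) j) l - coeff1 (a i r) l * coeff1 (a (Suc r) j) k))"
  (is "_ \<longleftrightarrow> ?D \<and> ?F \<and> ?E")
proof -
  have "d (a i j) = (\<Sum>r = i..j - 1. a i r \<and>\<^sub>F a (Suc r) j) \<longleftrightarrow>
     (\<forall>k l. 1 \<le> k \<and> k < l \<longrightarrow> (if k = 1 then coeff1 (a i j) (Suc l) else 0) =
        (\<Sum>r = i..j - 1. coeff1 (a i r) k * coeff1 (a (Suc r) j) l - coeff1 (a i r) l * coeff1 (a (Suc r) j) k))"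
    if ?F "1 \<le> i" "i \<le> j" "j \<le> length ws" for i j
    using that by (intro d_eq_sum_wedge_iff) auto
  note * = this
  show ?thesis
  proof (cases ?F)
    case True
    then show ?thesis unfolding flat_connection_def using *[OF True] by meson
  next
    case False
    then show ?thesis unfolding flat_connection_def by blast
  qed
qed

lemma flat_connection_imp_defining_system:
  "flat_connection ws a \<Longrightarrow> defining_system ws a"
  by (auto simp: flat_connection_def defining_system_def Let_def)

lemma flat_connection_imp_formal_connection:
  assumes "flat_connection ws a" "length ws \<ge> 1"
  shows "formal_connection ws (connection_matrix (length ws) a)"
  using assms flat_connection_imp_defining_system[OF assms(1)]
  by (auto simp: formal_connection_def flat_connection_def)

text \<open>The coboundaries form a group: it contains 0, so \<open>c\<close> lies in its own coset,
  and translation by one of its elements preserves it.\<close>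

lemma coh_class_2_eq_0_iff:
  "coh_class 2 c = coh_class 2 0 \<longleftrightarrow> (\<exists>x\<in>forms 1. c = d x)"
proof
  have cob: "coboundaries 2 = d ` (forms 1 :: 'a form set)"
    by (simp add: numeral_2_eq_2)
  have d0: "d 0 = 0" by (simp add: d_def)
  assume eq: "coh_class 2 c = coh_class 2 0"
  have "0 \<in> d ` (forms 1 :: 'a form set)"
    using d0 zero_in_forms by (metis image_eqI)
  then have "c \<in> coh_class 2 c"
    unfolding coh_class_def cob by force
  then show "\<exists>x\<in>forms 1. c = d x"
    unfolding eq by (auto simp: coh_class_def cob)
next
  have cob: "coboundaries 2 = d ` (forms 1 :: 'a form set)"
    by (simp add: numeral_2_eq_2)
  assume "\<exists>x\<in>forms 1. c = d x"
  then obtain x where x: "x \<in> forms 1" "c = d x" by blast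
  have "\<exists>z\<in>forms 1. d x + d y = d z" if "y \<in> forms 1" for y
    using that x d_add add_in_forms by metis
  moreover have "\<exists>z\<in>forms 1. d y = d x + d z" if "y \<in> forms 1" for y
    by (rule bexI[of _ "y - x"]) (use that x in \<open>simp_all add: d_diff diff_in_forms\<close>)
  ultimately show "coh_class 2 c = coh_class 2 0"
    unfolding coh_class_def cob x(2) by (simp add: set_eq_iff image_iff Bex_def) metis
qed

text \<open>A primitive of the related cocycle is exactly the corner entry that a defining system
  leaves open.\<close>

lemma massey_trivial_iff:
  assumes "length ws \<ge> 2" "set ws \<subseteq> cocycles 1"
  shows "massey_trivial ws \<longleftrightarrow> (\<exists>a. flat_connection ws a)"
proof
  assume "massey_trivial ws"
  then obtain a where a: "defining_system ws a" "coh_class 2 (related_cocycle ws a) = coh_class 2 0"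
    unfolding massey_trivial_def massey_product_def by force
  then obtain x where x: "x \<in> forms 1" "related_cocycle ws a = d x"
    by (auto simp: coh_class_2_eq_0_iff)
  define n where "n = length ws"
  define b where "b = (\<lambda>i j. if i = 1 \<and> j = n then x else a i j)"
  have "d (b i j) = (\<Sum>r = i..j - 1. b i r \<and>\<^sub>F b (Suc r) j)" if ij: "1 \<le> i" "i \<le> j" "j \<le> n" for i j
  proof -
    \<comment> \<open>The corner never occurs as a factor: in the first one the second index is
      below \<open>n\<close>, in the second one the first index exceeds 1.\<close>
    have rhs: "(\<Sum>r = i..j - 1. b i r \<and>\<^sub>F b (Suc r) j) = (\<Sum>r = i..j - 1. a i r \<and>\<^sub>F a (Suc r) j)"
      using ij by (intro sum.cong refl) (auto simp: b_def)
    consider "i = 1" "j = n" | "i = j" "(i, j) \<noteq> (1, n)" | "i < j" "(i, j) \<noteq> (1, n)"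
      using ij by fastforce
    then show ?thesis
    proof cases
      case 1
      then show ?thesis unfolding rhs using x by (simp add: b_def related_cocycle_def n_def)
    next
      \<comment> \<open>A defining system imposes no differential equation on the diagonal;
        closedness comes from the assumption on \<open>ws\<close>.\<close>
      case 2
      then have "b i j = ws ! (i - 1)"
        using a(1) ij by (auto simp: b_def defining_system_def n_def Let_def)
      then have "d (b i j) = 0"
        using assms(2) nth_mem[of "i - 1" ws] ij by (force simp: cocycles_def n_def)
      then show ?thesis unfolding rhs using 2 ij by simp
    next
      case 3
      then show ?thesis unfolding rhs using a(1) ij by (auto simp: b_def defining_system_def n_def Let_def)
    qed
  qed
  moreover have "b i j \<in> forms 1" if "1 \<le> i" "i \<le> j" "j \<le> n" for i j
    using a(1) x that by (auto simp: b_def defining_system_def n_def Let_def)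
  moreover have "b i i = ws ! (i - 1)" if "1 \<le> i" "i \<le> n" for i
    using a(1) x that assms(1) by (auto simp: b_def defining_system_def n_def Let_def)
  ultimately show "\<exists>a. flat_connection ws a"
    unfolding flat_connection_def n_def by blast
next
  assume "\<exists>a. flat_connection ws a"
  then obtain a where a: "flat_connection ws a" by blast
  then have "a 1 (length ws) \<in> forms 1" "related_cocycle ws a = d (a 1 (length ws))"
    using assms(1) by (auto simp: flat_connection_def related_cocycle_def)
  then have "coh_class 2 (related_cocycle ws a) = coh_class 2 0"
    by (auto simp: coh_class_2_eq_0_iff)
  then show "massey_trivial ws"
    unfolding massey_trivial_def massey_product_def
    using flat_connection_imp_defining_system[OF a] by force
qed

section \<open>Conjugation by diagonal matrices\<close>

text \<open>Conjugation by the diagonal matrix with entries \<open>c 0, ..., c n\<close> multiplies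
  \<open>a i j\<close> by \<open>c j / c (i - 1)\<close>; in each product the inner factor
  \<open>c r\<close> cancels.\<close>

lemma flat_connection_scale:
  assumes flat: "flat_connection ws a" and nz: "\<And>i. c i \<noteq> 0" and len: "length vs = length ws"
    and vs: "\<And>i. i < length ws \<Longrightarrow> vs ! i = (c (Suc i) / c i) *\<^sub>F ws ! i"
  shows "flat_connection vs (\<lambda>i j. (c j / c (i - 1)) *\<^sub>F a i j)"
  unfolding flat_connection_iff len
proof (intro conjI allI impI)
  fix i assume "1 \<le> i \<and> i \<le> length ws"
  then show "(c i / c (i - 1)) *\<^sub>F a i i = vs ! (i - 1)"
    using vs[of "i - 1"] flat by (auto simp: flat_connection_def)
next
  fix i j assume "1 \<le> i \<and> i \<le> j \<and> j \<le> length ws"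
  then show "(c j / c (i - 1)) *\<^sub>F a i j \<in> forms 1"
    using flat by (auto simp: flat_connection_def intro: scale_in_forms)
next
  fix i j k l :: nat assume *: "1 \<le> i \<and> i \<le> j \<and> j \<le> length ws \<and> 1 \<le> k \<and> k < l"
  let ?q = "c j / c (i - 1)"
  have "(if k = 1 then coeff1 (?q *\<^sub>F a i j) (Suc l) else 0) =
      ?q * (if k = 1 then coeff1 (a i j) (Suc l) else 0)"
    by (simp add: lookup_scale)
  also have "\<dots> = ?q * (\<Sum>r = i..j - 1. coeff1 (a i r) k * coeff1 (a (Suc r) j) l - coeff1 (a i r) l * coeff1 (a (Suc r) j) k)"
    using flat * unfolding flat_connection_iff by (blast intro: arg_cong[of _ _ "(*) ?q"])
  also have "\<dots> = (\<Sum>r = i..j - 1.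
       coeff1 ((c r / c (i - 1)) *\<^sub>F a i r) k * coeff1 ((c j / c (Suc r - 1)) *\<^sub>F a (Suc r) j) l -
       coeff1 ((c r / c (i - 1)) *\<^sub>F a i r) l * coeff1 ((c j / c (Suc r - 1)) *\<^sub>F a (Suc r) j) k)"
    unfolding sum_distrib_left using nz by (intro sum.cong refl) (simp add: lookup_scale field_simps)
  finally show "(if k = 1 then coeff1 (?q *\<^sub>F a i j) (Suc l) else 0) = \<dots>" .
qed

lemma massey_equivalent_scale:
  fixes c :: "nat \<Rightarrow> 'k::field_char_0"
  assumes flat: "flat_connection ws a" and nz: "\<And>i. c i \<noteq> 0" and len: "length vs = length ws"
    and vs: "\<And>i. i < length ws \<Longrightarrow> vs ! i = (c (Suc i) / c i) *\<^sub>F ws ! i" and "ws \<noteq> []"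
  shows "massey_equivalent ws vs"
proof -
  define n where "n = length ws"
  define a' where "a' = (\<lambda>i j. (c j / c (i - 1)) *\<^sub>F a i j)"
  define A where "A = connection_matrix n a"
  define A' where "A' = connection_matrix n a'"
  have flat': "flat_connection vs a'"
    unfolding a'_def by (rule flat_connection_scale[OF flat nz len vs])
  have len1: "length ws \<ge> 1" using \<open>ws \<noteq> []\<close> by (cases ws) auto
  have fc: "formal_connection ws A" "formal_connection vs A'"
    using flat_connection_imp_formal_connection[OF flat] flat_connection_imp_formal_connection[OF flat'] len1 len
    by (simp_all add: A_def A'_def n_def)
  \<comment> \<open>Matrix indices start at 0: the entry at \<open>(r, s)\<close> is
    \<open>a (r + 1) s\<close>, so its factor \<open>c s / c r\<close> is the one in
    \<open>a'\<close>.\<close>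
  define C where "C = mat (n + 1) (n + 1) (\<lambda>(r, s). if r = s then c r else 0)"
  define C' where "C' = mat (n + 1) (n + 1) (\<lambda>(r, s). if r = s then inverse (c r) else 0)"
  have dims: "C \<in> carrier_mat (n + 1) (n + 1)" "C' \<in> carrier_mat (n + 1) (n + 1)"
    by (auto simp: C_def C'_def)
  have inv: "inverts_mat C C'" "inverts_mat C' C"
    unfolding inverts_mat_def C_def C'_def
    by (rule eq_matI; auto simp: scalar_prod_def nz if_distrib[of "\<lambda>x. _ * x"] if_distrib[of "\<lambda>x. x * _"] cong: if_cong)+
  have L: "lmult_mat C' A = mat (n + 1) (n + 1) (\<lambda>(r, s). inverse (c r) *\<^sub>F A $$ (r, s))"
  proof (rule eq_matI)
    fix r s assume "r < dim_row (mat (n + 1) (n + 1) (\<lambda>(r, s). inverse (c r) *\<^sub>F A $$ (r, s)))"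
      "s < dim_col (mat (n + 1) (n + 1) (\<lambda>(r, s). inverse (c r) *\<^sub>F A $$ (r, s)))"
    then have rs: "r < n + 1" "s < n + 1" by auto
    have "lmult_mat C' A $$ (r, s) = (\<Sum>t<n + 1. C' $$ (r, t) *\<^sub>F A $$ (t, s))"
      using rs by (simp add: lmult_mat_def C'_def A_def connection_matrix_def)
    also have "\<dots> = (\<Sum>t<n + 1. if t = r then inverse (c r) *\<^sub>F A $$ (r, s) else 0)"
      using rs by (intro sum.cong refl) (auto simp: C'_def)
    finally show "lmult_mat C' A $$ (r, s) = mat (n + 1) (n + 1) (\<lambda>(r, s). inverse (c r) *\<^sub>F A $$ (r, s)) $$ (r, s)"
      using rs by simp
  qed (auto simp: lmult_mat_def A_def C'_def connection_matrix_def)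
  have "A' = rmult_mat (lmult_mat C' A) C"
  proof (rule eq_matI)
    fix r s assume "r < dim_row (rmult_mat (lmult_mat C' A) C)" "s < dim_col (rmult_mat (lmult_mat C' A) C)"
    then have rs: "r < n + 1" "s < n + 1" by (auto simp: rmult_mat_def L C_def)
    have "rmult_mat (lmult_mat C' A) C $$ (r, s) =
        (\<Sum>t<n + 1. C $$ (t, s) *\<^sub>F (inverse (c r) *\<^sub>F A $$ (r, t)))"
      using rs by (simp add: rmult_mat_def L C_def)
    also have "\<dots> = (\<Sum>t<n + 1. if t = s then c s *\<^sub>F (inverse (c r) *\<^sub>F A $$ (r, s)) else 0)"
      using rs by (intro sum.cong refl) (auto simp: C_def)
    also have "\<dots> = (c s / c r) *\<^sub>F A $$ (r, s)"
      using rs by (simp add: scale_scale divide_inverse)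
    also have "\<dots> = A' $$ (r, s)"
      using rs by (auto simp: A_def A'_def connection_matrix_def a'_def intro: poly_mapping_eqI simp: lookup_scale)
    finally show "A' $$ (r, s) = rmult_mat (lmult_mat C' A) C $$ (r, s)" by simp
  qed (auto simp: rmult_mat_def L A'_def C_def connection_matrix_def)
  then have "equivalent_mat (length ws + 1) A A'"
    unfolding equivalent_mat_def n_def[symmetric] using dims inv by blast
  then show ?thesis
    unfolding massey_equivalent_def using fc len by metis
qed


section \<open>Iterated brackets on the superdiagonal\<close>

text \<open>
  For matrices \<open>X\<close>, \<open>Y\<close> with superdiagonals \<open>a\<close>, \<open>b\<close> and zeros elsewhere, \<open>iter_bracket a b u i\<close> is the
  entry of \<open>ad\<^sub>X\<^sup>u Y\<close> in row \<open>i\<close> and column \<open>i + u + 1\<close>.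
\<close>

primrec iter_bracket :: "(nat \<Rightarrow> 'k::field_char_0) \<Rightarrow> (nat \<Rightarrow> 'k) \<Rightarrow> nat \<Rightarrow> nat \<Rightarrow> 'k" where
  "iter_bracket a b 0 i = b i"
| "iter_bracket a b (Suc u) i = a i * iter_bracket a b u (Suc i) - iter_bracket a b u i * a (Suc (i + u))"

text \<open>The entry is a linear form in \<open>b i, ..., b (i + u)\<close>, the window spanned by
  its row and column.\<close>

lemma iter_bracket_eq_0:
  "(\<And>s. i \<le> s \<Longrightarrow> s \<le> i + u \<Longrightarrow> b s = 0) \<Longrightarrow> iter_bracket a b u i = 0"
  by (induction u arbitrary: i) auto

text \<open>In the binomial expansion of the iterated bracket only the term with \<open>Y\<close> at
  position \<open>t\<close> survives; the \<open>u - t\<close> factors of \<open>X\<close> to its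
  right carry the sign. The value of \<open>a (i + t)\<close> never enters. The recursion is
  Pascal's rule.\<close>

lemma iter_bracket_single:
  assumes "t \<le> u" "b (i + t) = 1"
    and "\<And>s. s \<le> u \<Longrightarrow> s \<noteq> t \<Longrightarrow> b (i + s) = 0 \<and> a (i + s) = 1"
  shows "iter_bracket a b u i = (- 1) ^ (u - t) * of_nat (u choose t)"
  using assms
proof (induction u arbitrary: i t)
  case 0
  then show ?case by simp
next
  case (Suc u)
  consider "t = 0" | "t = Suc u" | t' where "t = Suc t'" "t' < u"
    using Suc.prems(1) by (cases t) (auto simp: le_less)
  then show ?case
  proof cases
    case 1
    have "iter_bracket a b u (Suc i) = 0"
    proof (rule iter_bracket_eq_0)
      fix s assume "Suc i \<le> s" "s \<le> Suc i + u"
      then show "b s = 0" using Suc.prems(3)[of "s - i"] 1 by auto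
    qed
    moreover have "iter_bracket a b u i = (- 1) ^ u"
      using Suc.IH[of 0 i] Suc.prems 1 by auto
    ultimately show ?thesis using 1 Suc.prems(3)[of "Suc u"] by simp
  next
    case 2
    have "iter_bracket a b u i = 0"
    proof (rule iter_bracket_eq_0)
      fix s assume "i \<le> s" "s \<le> i + u"
      then show "b s = 0" using Suc.prems(3)[of "s - i"] 2 by auto
    qed
    moreover have "iter_bracket a b u (Suc i) = 1"
      using Suc.IH[of u "Suc i"] Suc.prems(2) Suc.prems(3)[of "Suc s" for s] 2 by auto
    ultimately show ?thesis using 2 Suc.prems(3)[of 0] by simp
  next
    case 3
    have "iter_bracket a b u (Suc i) = (- 1) ^ (u - t') * of_nat (u choose t')"
      using Suc.IH[of t' "Suc i"] Suc.prems(2) Suc.prems(3)[of "Suc s" for s] 3 by auto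
    moreover have "iter_bracket a b u i = (- 1) ^ (u - t) * of_nat (u choose t)"
      using Suc.IH[of t i] Suc.prems 3 by auto
    moreover have "a i = 1" "a (Suc (i + u)) = 1"
      using Suc.prems(3)[of 0] Suc.prems(3)[of "Suc u"] 3 by auto
    moreover have "u - t' = Suc (u - t)" using 3 by auto
    ultimately show ?thesis using 3 by (simp add: algebra_simps)
  qed
qed

section \<open>Flat connections from commuting brackets\<close>

definition class_list :: "nat \<Rightarrow> (nat \<Rightarrow> 'k::field_char_0) \<Rightarrow> (nat \<Rightarrow> 'k) \<Rightarrow> 'k form list" where
  "class_list n a b = map (\<lambda>i. a i *\<^sub>F gen 1 + b i *\<^sub>F gen 2) [1..<n + 1]"

lemma length_class_list [simp]: "length (class_list n a b) = n"
  by (simp add: class_list_def)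

lemma nth_class_list [simp]:
  "i < n \<Longrightarrow> class_list n a b ! i = a (Suc i) *\<^sub>F gen 1 + b (Suc i) *\<^sub>F gen 2"
  by (simp add: class_list_def del: upt_Suc)

text \<open>The entry in row \<open>i\<close> and column \<open>i + u + v + 2\<close> of the
  commutator of the \<open>u\<close>-th and \<open>v\<close>-th iterated brackets vanishes; the
  bound on \<open>n\<close> keeps the column inside the matrix.\<close>

definition commuting_brackets :: "nat \<Rightarrow> (nat \<Rightarrow> 'k::field_char_0) \<Rightarrow> (nat \<Rightarrow> 'k) \<Rightarrow> bool" where
  "commuting_brackets n a b \<longleftrightarrow> (\<forall>i u v. 1 \<le> i \<and> i + u + v + 1 \<le> n \<longrightarrow>
     iter_bracket a b u i * iter_bracket a b v (i + u + 1) =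
     iter_bracket a b v i * iter_bracket a b u (i + v + 1))"

text \<open>The graded solution: its component along \<open>e\<^sup>k\<close> lies on the \<open>(k - 1)\<close>-st superdiagonal for \<open>k \<ge> 2\<close>.\<close>

lemma flat_connection_iter_bracket:
  fixes a b :: "nat \<Rightarrow> 'k::field_char_0"
  assumes comm: "commuting_brackets n a b"
  shows "\<exists>A. flat_connection (class_list n a b) A"
proof
  define y where "y = iter_bracket a b"
  define A where "A = (\<lambda>i j. (if i = j then a i else 0) *\<^sub>F gen 1 + y (j - i) i *\<^sub>F gen (j - i + 2))"
  have A1: "coeff1 (A i j) 1 = (if i = j then a i else 0)" for i j
    by (simp add: A_def lookup_add lookup_scale coeff1_gen)
  have A2: "coeff1 (A i j) k = (if k = j - i + 2 then y (j - i) i else 0)" if "k \<ge> 2" for i j k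
    using that by (simp add: A_def lookup_add lookup_scale coeff1_gen)
  show "flat_connection (class_list n a b) A"
    unfolding flat_connection_iff
  proof (intro conjI allI impI)
    fix i assume "1 \<le> i \<and> i \<le> length (class_list n a b)"
    then obtain m where "i = Suc m" "m < n" by (cases i) auto
    then show "A i i = class_list n a b ! (i - 1)"
      by (simp add: A_def y_def numeral_2_eq_2)
  next
    show "A i j \<in> forms 1" for i j
      unfolding A_def by (intro add_in_forms scale_in_forms gen_in_forms) auto
  next
    fix i j k l :: nat
    assume "1 \<le> i \<and> i \<le> j \<and> j \<le> length (class_list n a b) \<and> 1 \<le> k \<and> k < l"
    then have ij: "1 \<le> i" "i \<le> j" "j \<le> n" and kl: "1 \<le> k" "k < l" by simp_all
    show "(if k = 1 then coeff1 (A i j) (Suc l) else 0) =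
      (\<Sum>r = i..j - 1. coeff1 (A i r) k * coeff1 (A (Suc r) j) l - coeff1 (A i r) l * coeff1 (A (Suc r) j) k)"
    proof (cases "k = 1")
      case True
      show ?thesis
      proof (cases "i = j")
        case True
        then show ?thesis using ij kl by (simp add: A2)
      next
        case False
        then obtain u where j: "j = Suc (i + u)" using ij less_iff_Suc_add[of i j] by auto
        \<comment> \<open>The component at \<open>gen 1\<close> is confined to diagonal entries
          \<open>A i i\<close>, so only the first and the last splitting contribute; they form the
          recursion of \<open>iter_bracket\<close>.\<close>
        have "(\<Sum>r = i..j - 1. coeff1 (A i r) k * coeff1 (A (Suc r) j) l - coeff1 (A i r) l * coeff1 (A (Suc r) j) k)
          = (\<Sum>r = i..i + u. if r = i then (if l = u + 2 then a i * y u (Suc i) else 0) else 0) -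
            (\<Sum>r = i..i + u. if r = i + u then (if l = u + 2 then y u i * a j else 0) else 0)"
          unfolding sum_subtractf[symmetric] True j
          by (intro sum.cong) (use kl True in \<open>auto simp: A1[simplified] A2\<close>)
        also have "\<dots> = (if l = u + 2 then y (Suc u) i else 0)"
          by (simp add: y_def j)
        finally show ?thesis using kl True by (simp add: A2 j Suc_diff_le)
      qed
    next
      case False
      then have "k = k - 2 + 2" "l = l - 2 + 2" using kl by linarith+
      then obtain u v where uv: "k = u + 2" "l = v + 2" by blast
      \<comment> \<open>The component at \<open>u + 2\<close> requires an interval of exactly
        \<open>u + 1\<close> indices, so each of the two products fixes both \<open>r\<close> and
        \<open>j\<close>.\<close>
      have "(\<Sum>r = i..j - 1. coeff1 (A i r) k * coeff1 (A (Suc r) j) l - coeff1 (A i r) l * coeff1 (A (Suc r) j) k)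
          = (\<Sum>r = i..j - 1. if r = i + u then (if i + u + v + 1 = j then y u i * y v (i + u + 1) else 0) else 0) -
            (\<Sum>r = i..j - 1. if r = i + v then (if i + u + v + 1 = j then y v i * y u (i + v + 1) else 0) else 0)"
        unfolding sum_subtractf[symmetric]
      proof (rule sum.cong[OF refl])
        fix r assume "r \<in> {i..j - 1}"
        then obtain p q where r: "r = i + p" and j: "j = Suc (r + q)"
          using ij that[of "r - i" "j - Suc r"] by auto
        have "coeff1 (A i r) (w + 2) = (if w = p then y p i else 0)"
          "coeff1 (A (Suc r) j) (w + 2) = (if w = q then y q (Suc r) else 0)" for w
          by (simp_all add: A2 r j)
        then show "coeff1 (A i r) k * coeff1 (A (Suc r) j) l - coeff1 (A i r) l * coeff1 (A (Suc r) j) k =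
            (if r = i + u then if i + u + v + 1 = j then y u i * y v (i + u + 1) else 0 else 0) -
            (if r = i + v then if i + u + v + 1 = j then y v i * y u (i + v + 1) else 0 else 0)"
          unfolding uv by (simp add: r j)
      qed
      also have "\<dots> = 0"
        using comm ij by (auto simp: y_def commuting_brackets_def)
      finally show ?thesis using False by simp
    qed
  qed
qed

section \<open>Leading superdiagonals of an arbitrary flat connection\<close>

text \<open>Each bracket with the strictly upper triangular first component moves the support one
  superdiagonal further from the main diagonal. The leading superdiagonal depends only on those of
  the first two components, so the remaining entries of \<open>A\<close> need not be
  normalised.\<close>

lemma flat_connection_top_component:
  assumes flat: "flat_connection ws A"
    and ab: "\<And>i. 1 \<le> i \<Longrightarrow> i \<le> length ws \<Longrightarrow> ws ! (i - 1) = a i *\<^sub>F gen 1 + b i *\<^sub>F gen 2"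
    and "1 \<le> i" "i \<le> j" "j \<le> length ws"
  shows "j + 2 < i + k \<Longrightarrow> k \<ge> 2 \<Longrightarrow> coeff1 (A i j) k = 0"
    and "coeff1 (A i j) (j - i + 2) = iter_bracket a b (j - i) i"
proof -
  have E: "coeff1 (A i j) (Suc l) =
      (\<Sum>r = i..j - 1. coeff1 (A i r) 1 * coeff1 (A (Suc r) j) l - coeff1 (A i r) l * coeff1 (A (Suc r) j) 1)"
    if "1 \<le> i" "i \<le> j" "j \<le> length ws" "l \<ge> 2" for i j l
  proof -
    have "(if 1 = (1::nat) then coeff1 (A i j) (Suc l) else 0) =
      (\<Sum>r = i..j - 1. coeff1 (A i r) 1 * coeff1 (A (Suc r) j) l - coeff1 (A i r) l * coeff1 (A (Suc r) j) 1)"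
    proof -
      have "1 \<le> i \<and> i \<le> j \<and> j \<le> length ws \<and> 1 \<le> (1::nat) \<and> 1 < l"
        using that by simp
      then show ?thesis using flat unfolding flat_connection_iff by blast
    qed
    then show ?thesis by simp
  qed
  have diag: "A i i = a i *\<^sub>F gen 1 + b i *\<^sub>F gen 2" if "1 \<le> i" "i \<le> length ws" for i
    using flat ab that by (auto simp: flat_connection_def)
  \<comment> \<open>The index is shifted by 2 so that the base case is vacuous; in the step both
    parts of a splitting are strictly shorter than the interval.\<close>
  have vanish: "coeff1 (A i j) (k + 2) = 0" if "1 \<le> i" "i \<le> j" "j \<le> length ws" "j < i + k" for i j k
    using that
  proof (induction k arbitrary: i j)
    case (Suc k)
    have "coeff1 (A i j) (Suc (k + 2)) = (\<Sum>r = i..j - 1.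
        coeff1 (A i r) 1 * coeff1 (A (Suc r) j) (k + 2) - coeff1 (A i r) (k + 2) * coeff1 (A (Suc r) j) 1)"
      using Suc.prems by (intro E) auto
    also have "\<dots> = (\<Sum>r = i..j - 1. 0)"
    proof (rule sum.cong[OF refl])
      fix r assume r: "r \<in> {i..j - 1}"
      then have "coeff1 (A (Suc r) j) (k + 2) = 0" "coeff1 (A i r) (k + 2) = 0"
        using Suc by auto
      then show "coeff1 (A i r) 1 * coeff1 (A (Suc r) j) (k + 2) - coeff1 (A i r) (k + 2) * coeff1 (A (Suc r) j) 1 = 0"
        by simp
    qed
    finally show ?case by simp
  qed simp
  show "coeff1 (A i j) k = 0" if jk: "j + 2 < i + k" "k \<ge> 2"
  proof -
    obtain m where "k = m + 2" using jk(2) le_Suc_ex by (metis add.commute)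
    then show ?thesis using vanish[of i j m] assms(3-5) jk by simp
  qed
  have "coeff1 (A i (i + u)) (u + 2) = iter_bracket a b u i" if "1 \<le> i" "i + u \<le> length ws" for i u
    using that
  proof (induction u arbitrary: i)
    case 0
    then show ?case by (simp add: diag lookup_add lookup_scale coeff1_gen)
  next
    case (Suc u)
    have d1: "coeff1 (A s s) 1 = a s" if "1 \<le> s" "s \<le> length ws" for s
      using that by (simp add: diag lookup_add lookup_scale coeff1_gen)
    have "coeff1 (A i (i + Suc u)) (Suc (u + 2)) =
      (\<Sum>r = i..i + u. coeff1 (A i r) 1 * coeff1 (A (Suc r) (i + Suc u)) (u + 2)) -
      (\<Sum>r = i..i + u. coeff1 (A i r) (u + 2) * coeff1 (A (Suc r) (i + Suc u)) 1)"
      using E[of i "i + Suc u" "u + 2"] Suc.prems by (simp add: sum_subtractf)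
    also have "(\<Sum>r = i..i + u. coeff1 (A i r) 1 * coeff1 (A (Suc r) (i + Suc u)) (u + 2)) =
      (\<Sum>r = i..i + u. if r = i then a i * iter_bracket a b u (Suc i) else 0)"
    proof (rule sum.cong[OF refl])
      fix r assume r: "r \<in> {i..i + u}"
      show "coeff1 (A i r) 1 * coeff1 (A (Suc r) (i + Suc u)) (u + 2) =
          (if r = i then a i * iter_bracket a b u (Suc i) else 0)"
      proof (cases "r = i")
        case True
        then show ?thesis using Suc.IH[of "Suc i"] Suc.prems d1[of i] by simp
      next
        case False
        then show ?thesis using vanish[of "Suc r" "i + Suc u" u] r Suc.prems by simp
      qed
    qed
    also have "(\<Sum>r = i..i + u. coeff1 (A i r) (u + 2) * coeff1 (A (Suc r) (i + Suc u)) 1) =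
      (\<Sum>r = i..i + u. if r = i + u then iter_bracket a b u i * a (Suc (i + u)) else 0)"
    proof (rule sum.cong[OF refl])
      fix r assume r: "r \<in> {i..i + u}"
      show "coeff1 (A i r) (u + 2) * coeff1 (A (Suc r) (i + Suc u)) 1 =
          (if r = i + u then iter_bracket a b u i * a (Suc (i + u)) else 0)"
      proof (cases "r = i + u")
        case True
        then show ?thesis using Suc.IH[of i] Suc.prems d1[of "Suc (i + u)"] by simp
      next
        case False
        then show ?thesis using vanish[of i r u] r Suc.prems by simp
      qed
    qed
    finally show ?case by simp
  qed
  from this[of i "j - i"] show "coeff1 (A i j) (j - i + 2) = iter_bracket a b (j - i) i"
    using assms(3-5) by simp
qed

text \<open>The component along \<open>e\<^sup>2 \<and> e\<^bsup>t + 2\<^esup>\<close> of flatness, i.e. \<open>[Y, ad\<^sub>X\<^sup>t Y] = 0\<close>.\<close>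

lemma flat_connection_commutes:
  assumes flat: "flat_connection ws A"
    and ab: "\<And>i. 1 \<le> i \<Longrightarrow> i \<le> length ws \<Longrightarrow> ws ! (i - 1) = a i *\<^sub>F gen 1 + b i *\<^sub>F gen 2"
    and i: "1 \<le> i" and t: "1 \<le> t" and n: "i + t + 1 \<le> length ws"
  shows "b i * iter_bracket a b t (Suc i) = iter_bracket a b t i * b (i + t + 1)"
proof -
  let ?j = "Suc (i + t)"
  note top = flat_connection_top_component[OF flat ab]
  have "(if 2 = (1::nat) then coeff1 (A i ?j) (Suc (t + 2)) else 0) =
      (\<Sum>r = i..?j - 1. coeff1 (A i r) 2 * coeff1 (A (Suc r) ?j) (t + 2) - coeff1 (A i r) (t + 2) * coeff1 (A (Suc r) ?j) 2)"
  proof -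
    have "1 \<le> i \<and> i \<le> ?j \<and> ?j \<le> length ws \<and> 1 \<le> (2::nat) \<and> 2 < t + 2"
      using i t n by simp
    then show ?thesis using flat unfolding flat_connection_iff by blast
  qed
  then have "0 = (\<Sum>r = i..i + t. coeff1 (A i r) 2 * coeff1 (A (Suc r) ?j) (t + 2)) -
      (\<Sum>r = i..i + t. coeff1 (A i r) (t + 2) * coeff1 (A (Suc r) ?j) 2)"
    by (simp add: sum_subtractf)
  \<comment> \<open>A non-zero component at \<open>t + 2\<close> needs at least \<open>t + 1\<close>
    of the \<open>t + 2\<close> indices, which leaves one index for the other factor: only the
    extreme splittings remain.\<close>
  also have "(\<Sum>r = i..i + t. coeff1 (A i r) 2 * coeff1 (A (Suc r) ?j) (t + 2)) =
      (\<Sum>r = i..i + t. if r = i then b i * iter_bracket a b t (Suc i) else 0)"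
  proof (rule sum.cong[OF refl])
    fix r assume r: "r \<in> {i..i + t}"
    show "coeff1 (A i r) 2 * coeff1 (A (Suc r) ?j) (t + 2) = (if r = i then b i * iter_bracket a b t (Suc i) else 0)"
    proof (cases "r = i")
      case True
      then show ?thesis using top(2)[of i i] top(2)[of "Suc i" ?j] i n by (simp add: numeral_2_eq_2)
    next
      case False
      then show ?thesis using top(1)[of "Suc r" ?j "t + 2"] r i n by simp
    qed
  qed
  also have "(\<Sum>r = i..i + t. coeff1 (A i r) (t + 2) * coeff1 (A (Suc r) ?j) 2) =
      (\<Sum>r = i..i + t. if r = i + t then iter_bracket a b t i * b ?j else 0)"
  proof (rule sum.cong[OF refl])
    fix r assume r: "r \<in> {i..i + t}"
    show "coeff1 (A i r) (t + 2) * coeff1 (A (Suc r) ?j) 2 = (if r = i + t then iter_bracket a b t i * b ?j else 0)"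
    proof (cases "r = i + t")
      case True
      then show ?thesis using top(2)[of i "i + t"] top(2)[of ?j ?j] i n by (simp add: numeral_2_eq_2)
    next
      case False
      then show ?thesis using top(1)[of i r "t + 2"] r i n by simp
    qed
  qed
  finally show ?thesis by simp
qed


section \<open>The classification\<close>

lemma family_A_eq: "family_A n \<alpha> \<beta> = class_list n (\<lambda>_. \<alpha>) (\<lambda>_. \<beta>)"
  by (rule nth_equalityI) (simp_all add: family_A_def)

lemma family_B_eq: "family_B n \<alpha> \<beta> = class_list n (\<lambda>i. of_nat i * \<alpha> + \<beta>) (\<lambda>_. 1)"
  by (simp add: family_B_def class_list_def)

lemma family_C_eq:
  assumes "l < n"
  shows "family_C n l \<alpha> = class_list n (\<lambda>i. if i = Suc l then \<alpha> else 1) (\<lambda>i. if i = Suc l then 1 else 0)"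
  by (rule nth_equalityI) (use assms in \<open>auto simp: family_C_def nth_append nth_Cons' add.commute\<close>)

lemma family_D_eq:
  assumes "n = 2 * k + 2"
  shows "family_D k \<alpha> \<beta> = class_list n (\<lambda>i. if i = 1 then \<alpha> else if i = n then \<beta> else 1)
    (\<lambda>i. if i = 1 \<or> i = n then 1 else 0)"
  by (rule nth_equalityI) (use assms in \<open>auto simp: family_D_def nth_append nth_Cons' add.commute\<close>)

lemma iter_bracket_const:
  "iter_bracket (\<lambda>_. \<alpha>) (\<lambda>_. \<beta>) u i = (if u = 0 then \<beta> else 0)"
  by (induction u arbitrary: i) auto

text \<open>The \<open>u\<close>-th bracket is constant along its superdiagonal, so the next one
  multiplies it by the difference of \<open>a\<close> at \<open>i\<close> and
  \<open>Suc (i + u)\<close>, which is \<open>- (u + 1) * \<alpha>\<close>. Independence of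
  \<open>i\<close> yields commutation.\<close>

lemma iter_bracket_arith:
  "iter_bracket (\<lambda>i. of_nat i * \<alpha> + \<beta>) (\<lambda>_. 1) u i = (- \<alpha>) ^ u * fact u"
  by (induction u arbitrary: i) (simp_all add: algebra_simps)

lemma listed_products_commute:
  fixes ws :: "'k::field_char_0 form list"
  assumes ws: "ws \<in> listed_products n" and n: "n \<ge> 1"
  shows "\<exists>a b. ws = class_list n a b \<and> (\<forall>i. (a i, b i) \<noteq> (0, 0)) \<and> commuting_brackets n a b"
proof -
  consider (A) \<alpha> \<beta> where "ws = family_A n \<alpha> \<beta>" "(\<alpha>, \<beta>) \<noteq> (0, 0)"
    | (B) \<alpha> \<beta> where "ws = family_B n \<alpha> \<beta>"
    | (C) l \<alpha> where "ws = family_C n l \<alpha>" "l \<le> n - 1"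
    | (D) k \<alpha> \<beta> where "ws = family_D k \<alpha> \<beta>" "n = 2 * k + 2"
    using ws unfolding listed_products_def Un_iff mem_Collect_eq
    by (elim disjE exE conjE) (assumption | rule that)+
  then show ?thesis
  proof cases
    case A
    have "commuting_brackets n (\<lambda>_. \<alpha>) (\<lambda>_. \<beta>)"
      by (simp add: commuting_brackets_def iter_bracket_const)
    then show ?thesis using A unfolding family_A_eq by blast
  next
    case B
    have "commuting_brackets n (\<lambda>i. of_nat i * \<alpha> + \<beta>) (\<lambda>_. 1)"
      by (simp add: commuting_brackets_def iter_bracket_arith)
    then show ?thesis using B unfolding family_B_eq by (metis Pair_inject one_neq_zero)
  next
    case C
    then have "l < n" using n by simp
    define a where "a = (\<lambda>i. if i = Suc l then \<alpha> else 1)"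
    define b where "b = (\<lambda>i. if i = Suc l then 1 else (0 :: 'k))"
    \<comment> \<open>The two factors have disjoint windows, and only one position carries a
      non-zero \<open>b\<close>.\<close>
    have "iter_bracket a b u i * iter_bracket a b v (i + u + 1) = 0" for u v i
    proof (cases "Suc l \<le> i + u")
      case True
      then have "iter_bracket a b v (i + u + 1) = 0"
        by (intro iter_bracket_eq_0) (auto simp: b_def)
      then show ?thesis by simp
    next
      case False
      then have "iter_bracket a b u i = 0"
        by (intro iter_bracket_eq_0) (auto simp: b_def)
      then show ?thesis by simp
    qed
    then have "commuting_brackets n a b" by (simp add: commuting_brackets_def del: mult_eq_0_iff)
    moreover have "(a i, b i) \<noteq> (0, 0)" for i by (simp add: a_def b_def)
    moreover have "ws = class_list n a b"
      unfolding C(1) a_def b_def by (rule family_C_eq[OF \<open>l < n\<close>])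
    ultimately show ?thesis by blast
  next
    case D
    define a where "a = (\<lambda>i. if i = 1 then \<alpha> else if i = n then \<beta> else 1)"
    define b where "b = (\<lambda>i. if i = 1 \<or> i = n then 1 else (0 :: 'k))"
    have "iter_bracket a b u i * iter_bracket a b v (i + u + 1) =
        iter_bracket a b v i * iter_bracket a b u (i + v + 1)" if "1 \<le> i" "i + u + v + 1 \<le> n" for i u v
    proof -
      \<comment> \<open>Non-zero products need both end positions, hence the full range. There the
        two sides are the signs with exponents \<open>u\<close> and \<open>v\<close>, which agree
        because \<open>u + v = 2 * k\<close>.\<close>
      consider "i > 1" | "i + u + v + 1 < n" | "i = 1" "n = u + v + 2"
        using \<open>1 \<le> i\<close> \<open>i + u + v + 1 \<le> n\<close> by linarith
      then show ?thesis
      proof cases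
        case 1
        then have "iter_bracket a b u i = 0" "iter_bracket a b v i = 0"
          using that by (auto intro!: iter_bracket_eq_0 simp: b_def)
        then show ?thesis by simp
      next
        case 2
        then have "iter_bracket a b v (i + u + 1) = 0" "iter_bracket a b u (i + v + 1) = 0"
          using that by (auto intro!: iter_bracket_eq_0 simp: b_def)
        then show ?thesis by simp
      next
        case 3
        have left: "iter_bracket a b w 1 = (- 1) ^ w" if "w + 2 \<le> n" for w
          using iter_bracket_single[of 0 w b 1 a] that by (auto simp: a_def b_def)
        have right: "iter_bracket a b w m = 1" if "m + w = n" "m > 1" for w m
          using iter_bracket_single[of w w b m a] that by (auto simp: a_def b_def)
        have "u + v = 2 * k" using 3 D(2) by simp
        then have "even u \<longleftrightarrow> even v" by presburger
        then have "(- 1) ^ u = ((- 1) ^ v :: 'k)" by (simp add: minus_one_power_iff)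
        then show ?thesis
          using 3 left[of u] left[of v] right[of "u + 2" v] right[of "v + 2" u] by simp
      qed
    qed
    then have "commuting_brackets n a b" by (simp only: commuting_brackets_def) blast
    moreover have "(a i, b i) \<noteq> (0, 0)" for i by (simp add: a_def b_def)
    moreover have "ws = class_list n a b"
      unfolding D(1) a_def b_def by (rule family_D_eq[OF D(2)])
    ultimately show ?thesis by blast
  qed
qed

section \<open>Normalised solutions of the commutation relations\<close>

lemma class_list_cong:
  "(\<And>i. 1 \<le> i \<Longrightarrow> i \<le> n \<Longrightarrow> a i = a' i \<and> b i = b' i) \<Longrightarrow> class_list n a b = class_list n a' b'"
  unfolding class_list_def by (rule map_cong) auto

text \<open>After normalisation \<open>b\<close> is the indicator function of a set of positions.
  The cases are: empty, everything, one point, and at least two points but not everything.\<close>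

lemma commuting_class_list_listed:
  fixes a b :: "nat \<Rightarrow> 'k::field_char_0"
  assumes n: "n \<ge> 3"
    and norm: "\<And>i. 1 \<le> i \<Longrightarrow> i \<le> n \<Longrightarrow> b i = 1 \<or> b i = 0 \<and> a i = 1"
    and comm: "\<And>i t. 1 \<le> i \<Longrightarrow> 1 \<le> t \<Longrightarrow> i + t + 1 \<le> n \<Longrightarrow>
      b i * iter_bracket a b t (Suc i) = iter_bracket a b t i * b (i + t + 1)"
  shows "class_list n a b \<in> listed_products n"
proof -
  have triple: "2 * b i * a (i + 1) * b (i + 2) = b i * b (i + 1) * a (i + 2) + a i * b (i + 1) * b (i + 2)"
    if "1 \<le> i" "i + 2 \<le> n" for i
    using comm[of i 1] that by (simp add: algebra_simps)
  consider (none) "\<And>i. 1 \<le> i \<Longrightarrow> i \<le> n \<Longrightarrow> b i = 0"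
    | (all) "\<And>i. 1 \<le> i \<Longrightarrow> i \<le> n \<Longrightarrow> b i = 1"
    | (one) p where "1 \<le> p" "p \<le> n" "b p = 1" "\<And>i. 1 \<le> i \<Longrightarrow> i \<le> n \<Longrightarrow> i \<noteq> p \<Longrightarrow> b i = 0"
    | (two) p r s where "1 \<le> p" "p < r" "r \<le> n" "b p = 1" "b r = 1" "1 \<le> s" "s \<le> n" "b s = 0"
  proof -
    have zero: "b i = 0" if "1 \<le> i" "i \<le> n" "b i \<noteq> 1" for i
      using norm that by blast
    show thesis
    proof (cases "\<exists>p. 1 \<le> p \<and> p \<le> n \<and> b p = 1")
      case True
      then obtain p where p: "1 \<le> p" "p \<le> n" "b p = 1" by blast
      show thesis
      proof (cases "\<exists>r. 1 \<le> r \<and> r \<le> n \<and> r \<noteq> p \<and> b r = 1")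
        case True
        then obtain r where r: "1 \<le> r" "r \<le> n" "r \<noteq> p" "b r = 1" by blast
        show thesis
        proof (cases "\<exists>s. 1 \<le> s \<and> s \<le> n \<and> b s \<noteq> 1")
          case True
          then obtain s where "1 \<le> s" "s \<le> n" "b s = 0" using zero by blast
          then show thesis
            using two[of p r s] two[of r p s] p r by (cases "p < r") auto
        qed (use all in blast)
      next
        case False
        show thesis using one[OF p] zero False by blast
      qed
    qed (use none zero in blast)
  qed
  then show ?thesis
  proof cases
    case none
    then have "class_list n a b = family_A n 1 0"
      unfolding family_A_eq using none norm by (intro class_list_cong) force
    then show ?thesis unfolding listed_products_def by force
  next
    case all
    define \<delta> where "\<delta> = a 2 - a 1"
    \<comment> \<open>With all \<open>b\<close> equal to 1, \<open>triple\<close> says that second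
      differences of \<open>a\<close> vanish; two consecutive values are carried along for this
      recursion.\<close>
    have "a (Suc i) = a 1 + of_nat i * \<delta> \<and> a (Suc (Suc i)) = a 1 + of_nat (Suc i) * \<delta>" if "i + 2 \<le> n" for i
      using that
    proof (induction i)
      case 0
      then show ?case by (simp add: \<delta>_def numeral_2_eq_2)
    next
      case (Suc i)
      then have IH: "a (Suc i) = a 1 + of_nat i * \<delta>" "a (Suc (Suc i)) = a 1 + of_nat (Suc i) * \<delta>" by auto
      have "2 * a (Suc (Suc i)) = a (Suc (Suc (Suc i))) + a (Suc i)"
        using triple[of "Suc i"] all Suc.prems by simp
      then have "a (Suc (Suc (Suc i))) = 2 * a (Suc (Suc i)) - a (Suc i)" by simp
      also have "\<dots> = a 1 + of_nat (Suc (Suc i)) * \<delta>" unfolding IH by (simp add: algebra_simps)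
      finally show ?case using IH by simp
    qed
    note * = this
    define \<gamma> where "\<gamma> = a 1 - \<delta>"
    have arith: "a i = of_nat i * \<delta> + \<gamma>" if "1 \<le> i" "i \<le> n" for i
    proof (cases "i = 1")
      case False
      then have "i = Suc (Suc (i - 2))" using that by linarith
      then obtain j where "i = Suc (Suc j)" by blast
      then show ?thesis using *[of j] that by (simp add: algebra_simps \<gamma>_def)
    qed (simp add: \<gamma>_def)
    show ?thesis
    proof (cases "\<delta> = 0")
      case True
      then have "class_list n a b = family_A n \<gamma> 1"
        unfolding family_A_eq using all arith by (intro class_list_cong) simp
      then show ?thesis unfolding listed_products_def by force
    next
      case False
      have "class_list n a b = family_B n \<delta> \<gamma>"
        unfolding family_B_eq using all arith by (intro class_list_cong) simp
      then show ?thesis unfolding listed_products_def using False by blast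
    qed
  next
    case one
    then have "class_list n a b = class_list n (\<lambda>i. if i = Suc (p - 1) then a p else 1) (\<lambda>i. if i = Suc (p - 1) then 1 else 0)"
      using norm one by (intro class_list_cong) force
    then have "class_list n a b = family_C n (p - 1) (a p)"
      using one(1,2) by (subst family_C_eq) auto
    then show ?thesis unfolding listed_products_def using one(1,2) by (auto intro: diff_le_mono)
  next
    case two
    \<comment> \<open>If a zero followed two adjacent ones, \<open>triple\<close> would give
      \<open>a = 0\<close> there, against the normalisation \<open>a = 1\<close>; likewise on the
      left. So ones spread to all positions, including \<open>s\<close>.\<close>
    have nonadjacent: False if adj: "1 \<le> i" "Suc i \<le> n" "b i = 1" "b (Suc i) = 1" for i
    proof -
      have up: "b (Suc i + j) = 1 \<and> b (i + j) = 1" if "Suc i + j \<le> n" for j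
        using that
      proof (induction j)
        case (Suc j)
        then show ?case
          using triple[of "i + j"] norm[of "i + j + 2"] \<open>1 \<le> i\<close> by auto
      qed (use adj in simp)
      have down: "b (i - j) = 1 \<and> b (Suc (i - j)) = 1" if "j < i" for j
        using that
      proof (induction j)
        case (Suc j)
        then have "i - j = Suc (i - Suc j)" "1 \<le> i - Suc j" by linarith+
        then obtain m where m: "i - j = Suc m" "i - Suc j = m" "1 \<le> m" by blast
        then have "m + 2 \<le> n" using adj(2) by linarith
        moreover have "b (m + 1) = 1" "b (m + 2) = 1" using Suc m by simp_all
        ultimately have "b m = 1"
          using triple[of m] norm[of m] m(3) by auto
        then show ?case unfolding m(2) using \<open>b (m + 1) = 1\<close> by simp
      qed (use adj in simp)
      show False
        using up[of "s - Suc i"] down[of "i - s"] two by (cases "s \<le> i") auto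
    qed
    define q where "q = (LEAST q. p < q \<and> b q = 1)"
    have q: "p < q" "b q = 1" "q \<le> r"
      unfolding q_def using LeastI[of "\<lambda>q. p < q \<and> b q = 1" r] two
      by (auto intro: Least_le)
    have between: "b i = 0 \<and> a i = 1" if "p < i" "i < q" for i
    proof -
      have "b i \<noteq> 1" using not_less_Least[of i "\<lambda>q. p < q \<and> b q = 1"] that unfolding q_def by auto
      then show ?thesis using norm[of i] that q two by auto
    qed
    obtain m where m: "q = Suc (p + m)" using q(1) less_iff_Suc_add by blast
    have "m \<ge> 1" using nonadjacent[of p] two q m by (cases m) auto
    \<comment> \<open>The windows \<open>p + 1..q\<close> and \<open>p..q - 1\<close> contain a
      single one, at the last and first position respectively; the relation with
      \<open>t = m\<close> equates 1 with the resulting sign.\<close>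
    have "iter_bracket a b m (Suc p) = 1"
      using iter_bracket_single[of m m b "Suc p" a] between q(2) m by auto
    moreover have "iter_bracket a b m p = (- 1) ^ m"
      using iter_bracket_single[of 0 m b p a] between two(4) m by auto
    ultimately have "(- 1) ^ m = (1 :: 'k)"
      using comm[of p m] two q m \<open>m \<ge> 1\<close> by auto
    then have "even m" by (simp add: minus_one_power_iff split: if_splits)
    have "q = n"
    proof (rule ccontr)
      assume "q \<noteq> n"
      then have "Suc q \<le> n" using q two by simp
      then have next0: "b (Suc q) = 0" "a (Suc q) = 1"
        using nonadjacent[of q] norm[of "Suc q"] q two by auto
      \<comment> \<open>The window \<open>p + 1..q + 1\<close> has its one in the next-to-last
        place, so the binomial coefficient is \<open>m + 1\<close>, non-zero in characteristic zero.
        The relation at \<open>p\<close> forces 0, since \<open>b (Suc q) = 0\<close>.\<close>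
      have "iter_bracket a b (Suc m) (Suc p) = - of_nat (Suc m)"
      proof (subst iter_bracket_single[of m])
        fix s assume "s \<le> Suc m" "s \<noteq> m"
        then show "b (Suc p + s) = 0 \<and> a (Suc p + s) = 1"
          using between[of "Suc p + s"] next0 m by (cases "s = Suc m") auto
      qed (use q m in auto)
      moreover have "iter_bracket a b (Suc m) (Suc p) = 0"
        using comm[of p "Suc m"] two m next0 \<open>Suc q \<le> n\<close> by (simp del: iter_bracket.simps)
      ultimately show False by (simp del: of_nat_Suc)
    qed
    have "p = 1"
    proof (rule ccontr)
      assume "p \<noteq> 1"
      then obtain p' where p': "p = Suc p'" "1 \<le> p'" using two(1) by (cases p) auto
      have prev0: "b p' = 0" "a p' = 1"
        using nonadjacent[of p'] norm[of p'] two p' by auto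
      \<comment> \<open>The mirror image: the window starts one place before \<open>p\<close>, and
        the relation at \<open>p'\<close> has \<open>b p' = 0\<close> on the left and
        \<open>b q = 1\<close> on the right.\<close>
      have "iter_bracket a b (Suc m) p' = (- 1) ^ m * of_nat (Suc m)"
      proof (subst iter_bracket_single[of 1])
        fix s assume "s \<le> Suc m" "s \<noteq> 1"
        then show "b (p' + s) = 0 \<and> a (p' + s) = 1"
          using between[of "p' + s"] prev0 m p' by (cases s) auto
      qed (use two p' in auto)
      moreover have "iter_bracket a b (Suc m) p' = 0"
        using comm[of p' "Suc m"] two m p' prev0 q by (simp del: iter_bracket.simps)
      ultimately show False by (simp del: of_nat_Suc)
    qed
    obtain k where k: "m = 2 * k" using \<open>even m\<close> by (elim evenE)
    then have nk: "n = 2 * k + 2" using m \<open>q = n\<close> \<open>p = 1\<close> by simp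
    have "class_list n a b = family_D k (a 1) (a n)"
      unfolding family_D_eq[OF nk] using between two q \<open>q = n\<close> \<open>p = 1\<close> by (intro class_list_cong) auto
    moreover have "k \<ge> 1" using k \<open>m \<ge> 1\<close> by simp
    ultimately show ?thesis unfolding listed_products_def using nk by blast
  qed
qed

section \<open>The two directions of the classification\<close>

theorem theorem5p5:
  fixes n :: nat
  assumes "n \<ge> 3"
  shows "(\<forall>ws \<in> (listed_products n :: ('k::field_char_0) form list set).
            length ws = n \<and> (\<forall>\<omega>\<in>set ws. nonzero_H1 \<omega>) \<and> massey_defined ws \<and> massey_trivial ws) \<and>
         (\<forall>ws :: 'k form list.
            length ws = n \<and> (\<forall>\<omega>\<in>set ws. nonzero_H1 \<omega>) \<and> massey_defined ws \<and> massey_trivial ws \<longrightarrow>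
            (\<exists>vs \<in> listed_products n. massey_equivalent ws vs))"
proof (intro conjI ballI allI impI)
  fix ws :: "'k form list" assume "ws \<in> listed_products n"
  moreover have "n \<ge> 1" using assms by simp
  ultimately obtain a b where ws: "ws = class_list n a b" and nz: "\<And>i. (a i, b i) \<noteq> (0, 0)"
    and comm: "commuting_brackets n a b"
    using listed_products_commute by blast
  obtain A where A: "flat_connection ws A"
    using flat_connection_iter_bracket[OF comm] ws by blast
  show "length ws = n" by (simp add: ws)
  show nonzero: "nonzero_H1 \<omega>" if "\<omega> \<in> set ws" for \<omega>
    using that nz unfolding ws class_list_def nonzero_H1_iff by auto
  show "massey_defined ws"
    unfolding massey_defined_def using flat_connection_imp_defining_system[OF A] by blast
  have "set ws \<subseteq> cocycles 1" using nonzero by (auto simp: nonzero_H1_def)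
  then show "massey_trivial ws"
    using massey_trivial_iff[of ws] A assms by (auto simp: ws)
next
  fix ws :: "'k form list"
  assume ws: "length ws = n \<and> (\<forall>\<omega>\<in>set ws. nonzero_H1 \<omega>) \<and> massey_defined ws \<and> massey_trivial ws"
  then have "set ws \<subseteq> cocycles 1" by (auto simp: nonzero_H1_def)
  then obtain A where A: "flat_connection ws A"
    using massey_trivial_iff[of ws] ws assms by auto
  \<comment> \<open>Outside \<open>1..n\<close> some non-zero pair is chosen as well, so that every
    \<open>x i\<close> and every \<open>c i\<close> below is non-zero.\<close>
  have "\<forall>i. \<exists>\<alpha> \<beta>. (\<alpha>, \<beta>) \<noteq> (0, 0) \<and> (1 \<le> i \<and> i \<le> n \<longrightarrow> ws ! (i - 1) = \<alpha> *\<^sub>F gen 1 + \<beta> *\<^sub>F gen 2)"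
  proof
    fix i
    show "\<exists>\<alpha> \<beta>. (\<alpha>, \<beta>) \<noteq> (0, 0) \<and> (1 \<le> i \<and> i \<le> n \<longrightarrow> ws ! (i - 1) = \<alpha> *\<^sub>F gen 1 + \<beta> *\<^sub>F gen 2)"
    proof (cases "1 \<le> i \<and> i \<le> n")
      case True
      then have "nonzero_H1 (ws ! (i - 1))" using ws by auto
      then show ?thesis unfolding nonzero_H1_iff by blast
    next
      case False
      then show ?thesis by (metis Pair_inject one_neq_zero)
    qed
  qed
  then obtain \<alpha> \<beta> where nz: "\<And>i. (\<alpha> i, \<beta> i) \<noteq> (0, 0)"
    and nth: "\<And>i. 1 \<le> i \<Longrightarrow> i \<le> n \<Longrightarrow> ws ! (i - 1) = \<alpha> i *\<^sub>F gen 1 + \<beta> i *\<^sub>F gen 2"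
    by metis
  define x where "x = (\<lambda>i. if \<beta> i = 0 then inverse (\<alpha> i) else inverse (\<beta> i))"
  define a where "a = (\<lambda>i. x i * \<alpha> i)"
  define b where "b = (\<lambda>i. x i * \<beta> i)"
  \<comment> \<open>Partial products make the ratio of consecutive entries equal to
    \<open>x (Suc i)\<close>, so the conjugation rescales each form separately.\<close>
  define c where "c = (\<lambda>i. \<Prod>s = 1..i. x s)"
  have x: "x i \<noteq> 0" for i using nz[of i] by (auto simp: x_def)
  then have c: "c i \<noteq> 0" for i by (simp add: c_def)
  have norm: "b i = 1 \<or> b i = 0 \<and> a i = 1" for i
    using nz[of i] by (auto simp: a_def b_def x_def)
  have scaled: "class_list n a b ! i = (c (Suc i) / c i) *\<^sub>F ws ! i" if "i < length ws" for i
  proof -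
    have "c (Suc i) / c i = x (Suc i)" using c[of i] by (simp add: c_def)
    then show ?thesis
      using that ws nth[of "Suc i"] by (simp add: a_def b_def scale_add_right scale_scale)
  qed
  have flat: "flat_connection (class_list n a b) (\<lambda>i j. (c j / c (i - 1)) *\<^sub>F A i j)"
    by (rule flat_connection_scale[OF A c _ scaled]) (simp_all add: ws)
  have "b i * iter_bracket a b t (Suc i) = iter_bracket a b t i * b (i + t + 1)"
    if "1 \<le> i" "1 \<le> t" "i + t + 1 \<le> n" for i t
    by (rule flat_connection_commutes[OF flat]) (use that in auto)
  then have "class_list n a b \<in> listed_products n"
    using norm assms by (intro commuting_class_list_listed) auto
  moreover have "massey_equivalent ws (class_list n a b)"
    by (rule massey_equivalent_scale[OF A c _ scaled]) (use ws assms in auto)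
  ultimately show "\<exists>vs\<in>listed_products n. massey_equivalent ws vs" by blast
qed

end
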